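(* Let a group $G$ act 3-discontinuously on a compactum $X=T\sqcup A$, where $T=\Lambda G$ is the limit set and $A$ is a non-empty, discrete and $G$-finite set. Suppose $H$ is a dynamically bounded subgroup of $G$ acting cocompactly on $T\setminus\Lambda H$. Then $H$ acts cocompactly on $X\setminus\Lambda H$.
   Context: A compactum is a compact Hausdorff space (with more than two points). An action of a discrete group $G$ on $X$ by homeomorphisms is 3-discontinuous if the induced action on the space $\Theta^3X$ of 3-element subsets is properly discontinuous. It is assumed neither that the action is 2-cocompact nor that $G$ is finitely generated. The limit set $\Lambda G$ is the complement of the set of points having a neighborhood $U$ with $gU\cap U\neq\varnothing$ for only finitely many $g$; $\Lambda H$ is the limit set of $H$ acting on $X$. $G$-finite means $|A/G|<\infty$. A subgroup $H$ of $G$ is dynamically bounded if every infinite set $S\subset G$ of elements pairwise distinct modulo $H$ (i.e. lying in pairwise distinct left cosets $gH$) contains an infinite subset $S_0$ such that $T\setminus\bigcup_{s\in S_0}s(\Lambda H)$ has non-empty interior in $T$. *)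

theory Defs
  imports "HOL-Analysis.Analysis" "HOL-Algebra.Group_Action"
begin

definition compactum :: "'b topology \<Rightarrow> bool" where
  "compactum X \<longleftrightarrow> compact_space X \<and> Hausdorff_space X
     \<and> (infinite (topspace X) \<or> card (topspace X) > 2)"

text \<open>Only the restriction of \<open>\<phi> g\<close> to the space matters; outside it, \<^locale>\<open>group_action\<close> makes
  \<open>\<phi> g\<close> undefined.\<close>

definition acts_by_homeos :: "('g, 'm) monoid_scheme \<Rightarrow> 'b topology \<Rightarrow> ('g \<Rightarrow> 'b \<Rightarrow> 'b) \<Rightarrow> bool" where
  "acts_by_homeos G X \<phi> \<longleftrightarrow>
     group_action G (topspace X) \<phi> \<and> (\<forall>g\<in>carrier G. homeomorphic_map X X (\<phi> g))"

text \<open>The space of 3-element subsets carries the quotient topology from the subspace of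
  \<open>X \<times> X \<times> X\<close> of ordered triples of pairwise distinct points; see
  \<open>quotient_map_three_subsets\<close> below.\<close>

definition distinct_triples :: "'b topology \<Rightarrow> ('b \<times> 'b \<times> 'b) set" where
  "distinct_triples X =
     {(x, y, z). x \<in> topspace X \<and> y \<in> topspace X \<and> z \<in> topspace X \<and> x \<noteq> y \<and> x \<noteq> z \<and> y \<noteq> z}"

definition distinct_triples_topology :: "'b topology \<Rightarrow> ('b \<times> 'b \<times> 'b) topology" where
  "distinct_triples_topology X =
     subtopology (prod_topology X (prod_topology X X)) (distinct_triples X)"

definition three_subsets :: "'b topology \<Rightarrow> 'b set topology" where
  "three_subsets X = topology (\<lambda>\<U>.
     \<U> \<subseteq> {P. P \<subseteq> topspace X \<and> card P = 3} \<and>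
     openin (distinct_triples_topology X) {(x, y, z) \<in> distinct_triples X. {x, y, z} \<in> \<U>})"

lemma openin_three_subsets:
  "openin (three_subsets X) \<U> \<longleftrightarrow>
     \<U> \<subseteq> {P. P \<subseteq> topspace X \<and> card P = 3} \<and>
     openin (distinct_triples_topology X) {(x, y, z) \<in> distinct_triples X. {x, y, z} \<in> \<U>}"
proof -
  let ?p = "\<lambda>\<U>. {(x, y, z) \<in> distinct_triples X. {x, y, z} \<in> \<U>}"
  have "istopology (\<lambda>\<U>. \<U> \<subseteq> {P. P \<subseteq> topspace X \<and> card P = 3} \<and>
     openin (distinct_triples_topology X) (?p \<U>))"
    unfolding istopology_def
  proof (intro conjI allI impI)
    fix S T
    assume S: "S \<subseteq> {P. P \<subseteq> topspace X \<and> card P = 3} \<and> openin (distinct_triples_topology X) (?p S)"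
      and T: "T \<subseteq> {P. P \<subseteq> topspace X \<and> card P = 3} \<and> openin (distinct_triples_topology X) (?p T)"
    show "S \<inter> T \<subseteq> {P. P \<subseteq> topspace X \<and> card P = 3}" using S by blast
    have "?p (S \<inter> T) = ?p S \<inter> ?p T" by auto
    then show "openin (distinct_triples_topology X) (?p (S \<inter> T))" using S T by auto
  next
    fix K
    assume K: "\<forall>S\<in>K. S \<subseteq> {P. P \<subseteq> topspace X \<and> card P = 3} \<and>
                 openin (distinct_triples_topology X) (?p S)"
    show "\<Union>K \<subseteq> {P. P \<subseteq> topspace X \<and> card P = 3}" using K by blast
    have "?p (\<Union>K) = \<Union>(?p ` K)" by auto
    then show "openin (distinct_triples_topology X) (?p (\<Union>K))"
      using K by (metis (no_types, lifting) imageE openin_Union)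
  qed
  then show ?thesis
    by (simp add: three_subsets_def topology_inverse')
qed

lemma topspace_distinct_triples_topology [simp]:
  "topspace (distinct_triples_topology X) = distinct_triples X"
  by (auto simp: distinct_triples_topology_def distinct_triples_def)

lemma topspace_three_subsets [simp]:
  "topspace (three_subsets X) = {P. P \<subseteq> topspace X \<and> card P = 3}"
proof
  show "topspace (three_subsets X) \<subseteq> {P. P \<subseteq> topspace X \<and> card P = 3}"
    using openin_three_subsets openin_topspace by blast
  have "{(x, y, z) \<in> distinct_triples X. {x, y, z} \<in> {P. P \<subseteq> topspace X \<and> card P = 3}}
        = topspace (distinct_triples_topology X)"
    by (auto simp: distinct_triples_def)
  then have "openin (three_subsets X) {P. P \<subseteq> topspace X \<and> card P = 3}"
    by (simp only: openin_three_subsets openin_topspace order_refl simp_thms)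
  then show "{P. P \<subseteq> topspace X \<and> card P = 3} \<subseteq> topspace (three_subsets X)"
    by (rule openin_subset)
qed

lemma quotient_map_three_subsets:
  "quotient_map (distinct_triples_topology X) (three_subsets X) (\<lambda>(x, y, z). {x, y, z})"
proof -
  have "(\<lambda>(x, y, z). {x, y, z}) ` distinct_triples X = {P. P \<subseteq> topspace X \<and> card P = 3}"
  proof (intro equalityI subsetI)
    fix P assume "P \<in> (\<lambda>(x, y, z). {x, y, z}) ` distinct_triples X"
    then show "P \<in> {P. P \<subseteq> topspace X \<and> card P = 3}"
      by (auto simp: distinct_triples_def)
  next
    fix P assume P: "P \<in> {P. P \<subseteq> topspace X \<and> card P = 3}"
    then obtain x y z where "P = {x, y, z}" "x \<noteq> y" "x \<noteq> z" "y \<noteq> z"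
      by (auto simp: card_3_iff)
    with P have "(x, y, z) \<in> distinct_triples X" "P = (\<lambda>(x, y, z). {x, y, z}) (x, y, z)"
      by (auto simp: distinct_triples_def)
    then show "P \<in> (\<lambda>(x, y, z). {x, y, z}) ` distinct_triples X" by blast
  qed
  moreover have "{t \<in> distinct_triples X. (\<lambda>(x, y, z). {x, y, z}) t \<in> U}
      = {(x, y, z) \<in> distinct_triples X. {x, y, z} \<in> U}" for U
    by auto
  ultimately show ?thesis
    by (simp add: quotient_map_def openin_three_subsets)
qed

text \<open>In the following, \<open>H\<close> is the set of acting elements (the carrier of a group or a subgroup).\<close>

definition properly_discontinuous :: "'g set \<Rightarrow> 'b topology \<Rightarrow> ('g \<Rightarrow> 'b \<Rightarrow> 'b) \<Rightarrow> bool" where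
  "properly_discontinuous H Y \<phi> \<longleftrightarrow>
     (\<forall>K. compactin Y K \<longrightarrow> finite {h \<in> H. \<phi> h ` K \<inter> K \<noteq> {}})"

definition three_discontinuous ::
  "('g, 'm) monoid_scheme \<Rightarrow> 'b topology \<Rightarrow> ('g \<Rightarrow> 'b \<Rightarrow> 'b) \<Rightarrow> bool" where
  "three_discontinuous G X \<phi> \<longleftrightarrow>
     acts_by_homeos G X \<phi> \<and>
     properly_discontinuous (carrier G) (three_subsets X) (\<lambda>g P. \<phi> g ` P)"

definition limit_set :: "'g set \<Rightarrow> 'b topology \<Rightarrow> ('g \<Rightarrow> 'b \<Rightarrow> 'b) \<Rightarrow> 'b set" where
  "limit_set H X \<phi> = topspace X -
     {x \<in> topspace X. \<exists>U. openin X U \<and> x \<in> U \<and> finite {h \<in> H. \<phi> h ` U \<inter> U \<noteq> {}}}"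

text \<open>Cocompactness: the translates of some compact set cover. (On locally compact spaces this is
  the same as compactness of the orbit space.)\<close>

definition acts_cocompactly :: "'g set \<Rightarrow> 'b topology \<Rightarrow> ('g \<Rightarrow> 'b \<Rightarrow> 'b) \<Rightarrow> bool" where
  "acts_cocompactly H Y \<phi> \<longleftrightarrow> (\<exists>K. compactin Y K \<and> (\<Union>h\<in>H. \<phi> h ` K) = topspace Y)"

definition dynamically_bounded ::
  "('g, 'm) monoid_scheme \<Rightarrow> 'b topology \<Rightarrow> ('g \<Rightarrow> 'b \<Rightarrow> 'b) \<Rightarrow> 'g set \<Rightarrow> bool" where
  "dynamically_bounded G X \<phi> H \<longleftrightarrow>
     (let T = limit_set (carrier G) X \<phi> in
      \<forall>S. S \<subseteq> carrier G \<and> infinite S \<and>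
          (\<forall>s\<in>S. \<forall>t\<in>S. s \<noteq> t \<longrightarrow> s <#\<^bsub>G\<^esub> H \<noteq> t <#\<^bsub>G\<^esub> H) \<longrightarrow>
        (\<exists>S0. S0 \<subseteq> S \<and> infinite S0 \<and>
           subtopology X T interior_of (T - (\<Union>s\<in>S0. \<phi> s ` limit_set H X \<phi>)) \<noteq> {}))"

end

theory Submission
  imports Defs
begin

text \<open>Write \<open>\<Lambda>\<close> for the limit set of \<open>H\<close>. Thicken a compact set \<open>K \<subseteq> T - \<Lambda>\<close>, whose
\<open>H\<close>-translates cover \<open>T - \<Lambda>\<close>, to an open set \<open>U\<close> of \<open>X\<close> whose closure misses \<open>\<Lambda>\<close>. The points
of \<open>X\<close> outside \<open>H U\<close> form a closed \<open>H\<close>-invariant set \<open>E\<close> with \<open>E \<inter> T \<subseteq> \<Lambda>\<close>, so everything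
reduces to showing that \<open>E \<inter> A\<close> is finite modulo \<open>H\<close>. As \<open>A\<close> has finitely many \<open>G\<close>-orbits, a
failure gives one point \<open>a \<in> A\<close> and infinitely many \<open>g\<close> with \<open>g a \<in> E\<close> that represent
pairwise distinct cosets \<open>H g\<close>.

Dynamical boundedness, applied to the inverses of these \<open>g\<close>, leaves infinitely many of them and a
non-empty open \<open>V \<subseteq> T\<close> disjoint from every \<open>g\<inverse> \<Lambda>\<close>. Fix \<open>v \<in> V\<close>. Then \<open>g v \<in> T - \<Lambda>\<close>, so after
multiplying \<open>g\<close> on the left by an element of \<open>H\<close> we may take \<open>g v \<in> K\<close>, still with \<open>g a \<in> E\<close>.
Three-discontinuity yields the convergence property (\<open>ultra_collapses\<close>): along an ultrafilter the
\<open>g\<close> contract everything but a point \<open>r \<in> T\<close> to a point \<open>s \<in> T\<close>. Since \<open>a \<noteq> r\<close>, the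
point \<open>s\<close> is the limit of \<open>g a\<close> and hence lies in \<open>E \<inter> T \<subseteq> \<Lambda>\<close>; since \<open>g v \<in> K\<close> does not
accumulate at \<open>\<Lambda>\<close>, the exceptional point must be \<open>r = v\<close>. Consequently \<open>g\<inverse> t\<close> tends to \<open>v\<close> for
every \<open>t \<noteq> s\<close>; if \<open>t \<in> \<Lambda>\<close>, this contradicts \<open>g\<inverse> \<Lambda> \<inter> V = {}\<close>. So \<open>\<Lambda> = {s}\<close>, and \<open>g\<inverse> s\<close>, which
stays in \<open>T - V\<close>, accumulates at some \<open>p \<noteq> v\<close>: the single limit point \<open>s\<close> of \<open>H\<close> is conical.

That is impossible (\<open>unique_limit_point_not_conical\<close>). The conjugates \<open>g\<inverse> h g\<close> with \<open>h \<in> H\<close> fix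
points near \<open>p\<close> and move points near \<open>v\<close> to points near \<open>v\<close>, so that their attractor and
repeller are \<open>p\<close> and \<open>v\<close>. One of them therefore plays ping-pong between neighbourhoods of \<open>p\<close> and
\<open>v\<close>. Conjugated back to \<open>H\<close>, this produces limit points outside the side that contains \<open>s\<close>
(\<open>ping_pong_escapes\<close>), although \<open>s\<close> is the only one.

Ultrafilters replace sequences throughout: \<open>X\<close> may fail to be metrizable, and \<open>G\<close> may be
uncountable.\<close>

section \<open>Ultrafilters and limits along them\<close>

definition ultrafilter :: "'i filter \<Rightarrow> bool" where
  "ultrafilter F \<longleftrightarrow> F \<noteq> bot \<and> (\<forall>P. eventually P F \<or> eventually (\<lambda>i. \<not> P i) F)"

lemma ultra_not_eventually:
  assumes "ultrafilter F"
  shows "\<not> eventually P F \<longleftrightarrow> eventually (\<lambda>i. \<not> P i) F"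
  using assms eventually_conj[of P F "\<lambda>i. \<not> P i"] eventually_False[of F]
  unfolding ultrafilter_def by auto

text \<open>Zorn's lemma for proper filters below \<open>F\<close>: the infimum of a chain is proper, because an event of
the infimum is already an event of one member of the chain.\<close>

lemma ultra_refinement_exists:
  fixes F :: "'i filter"
  assumes "F \<noteq> bot"
  obtains U where "U \<le> F" "ultrafilter U"
proof -
  let ?A = "{E. E \<le> F \<and> E \<noteq> bot}"
  have po: "partial_order_on ?A (relation_of (\<ge>) ?A)"
    by (rule partial_order_on_relation_ofI) auto
  have "\<exists>u\<in>?A. \<forall>a\<in>C. a \<ge> u" if C: "C \<in> Chains (relation_of (\<ge>) ?A)" for C
  proof (cases "C = {}")
    case True
    then show ?thesis using assms by auto
  next
    case False
    have CA: "a \<in> ?A" if "a \<in> C" for a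
      using C that unfolding Chains_def relation_of_def by auto
    have lin: "a \<le> b \<or> b \<le> a" if "a \<in> C" "b \<in> C" for a b
      using C that unfolding Chains_def relation_of_def by auto
    have "eventually P (Inf C) \<longleftrightarrow> (\<exists>b\<in>C. eventually P b)" for P
    proof (rule eventually_Inf_base[OF False])
      fix a b assume "a \<in> C" "b \<in> C"
      then show "\<exists>x\<in>C. x \<le> inf a b" using lin[of a b] by (metis inf.absorb1 inf.absorb2 order_refl)
    qed
    then have "Inf C \<noteq> bot"
      using CA unfolding trivial_limit_def by simp
    moreover have "Inf C \<le> F"
      using False CA by (metis (no_types, lifting) Inf_lower ex_in_conv mem_Collect_eq order_trans)
    ultimately show ?thesis by (auto intro: Inf_lower)
  qed
  from predicate_Zorn[OF po this] obtain U where U: "U \<in> ?A" and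
    max: "\<And>E. E \<in> ?A \<Longrightarrow> E \<le> U \<Longrightarrow> E = U"
    by auto
  have "eventually P U \<or> eventually (\<lambda>i. \<not> P i) U" for P
  proof (rule ccontr)
    assume no: "\<not> ?thesis"
    \<comment> \<open>Adjoining \<open>P\<close> to \<open>U\<close> keeps it proper, so maximality gives \<open>P\<close> after all.\<close>
    let ?E = "inf U (principal {i. P i})"
    have "eventually Q ?E \<longleftrightarrow> eventually (\<lambda>i. P i \<longrightarrow> Q i) U" for Q
      by (simp add: eventually_inf_principal)
    then have "?E \<noteq> bot" "\<not> eventually P U" "eventually P ?E"
      using no unfolding trivial_limit_def by auto
    then show False using max[of ?E] U by (metis (mono_tags, lifting) inf.coboundedI1 inf_le1 mem_Collect_eq)
  qed
  then show thesis using that U unfolding ultrafilter_def by auto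
qed

text \<open>The source of all limits below: an infinite set of group elements carries an ultrafilter that is
not concentrated on finitely many of them.\<close>

lemma ultra_on_infinite_set:
  assumes "infinite S"
  obtains U where "ultrafilter U" "\<forall>\<^sub>F i in U. i \<in> S" "\<forall>B. finite B \<longrightarrow> (\<forall>\<^sub>F i in U. i \<notin> B)"
proof -
  have ev: "eventually P (inf cofinite (principal S)) \<longleftrightarrow> finite {i\<in>S. \<not> P i}" for P
    unfolding eventually_inf_principal eventually_cofinite by (rule arg_cong[of _ _ finite]) auto
  then have "inf cofinite (principal S) \<noteq> bot"
    unfolding trivial_limit_def using assms by simp
  then obtain U where "U \<le> inf cofinite (principal S)" "ultrafilter U"
    using ultra_refinement_exists by blast
  moreover have "eventually (\<lambda>i. i \<in> S) (inf cofinite (principal S))"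
    by (simp add: ev)
  moreover have "eventually (\<lambda>i. i \<notin> B) (inf cofinite (principal S))" if "finite B" for B
    using that by (simp add: ev)
  ultimately show thesis using that filter_leD by metis
qed

lemma ultra_limit_exists:
  assumes "compact_space X" "ultrafilter F" "\<forall>\<^sub>F i in F. f i \<in> topspace X"
  obtains l where "limitin X f l F"
proof (rule ccontr)
  assume "\<not> thesis"
  then have nolim: "\<not> limitin X f l F" for l using that by blast
  let ?\<W> = "{W. openin X W \<and> (\<forall>\<^sub>F i in F. f i \<notin> W)}"
  have "\<exists>W\<in>?\<W>. l \<in> W" if "l \<in> topspace X" for l
    using nolim[of l] that ultra_not_eventually[OF assms(2)] unfolding limitin_def by auto
  then have "topspace X \<subseteq> \<Union>?\<W>" by blast
  then obtain \<F> where "finite \<F>" "\<F> \<subseteq> ?\<W>" "topspace X \<subseteq> \<Union>\<F>"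
    using assms(1) unfolding compact_space_alt by (metis (no_types, lifting) mem_Collect_eq)
  then have "\<forall>\<^sub>F i in F. \<forall>W\<in>\<F>. f i \<notin> W" by (subst eventually_ball_finite_distrib) auto
  then have "\<forall>\<^sub>F i in F. False"
    using assms(3) by eventually_elim (use \<open>topspace X \<subseteq> \<Union>\<F>\<close> in blast)
  then show False using assms(2) unfolding ultrafilter_def by simp
qed

lemma limitin_closed_mem:
  assumes "limitin X f l F" "F \<noteq> bot" "closedin X C" "\<forall>\<^sub>F i in F. f i \<in> C"
  shows "l \<in> C"
proof (rule ccontr)
  assume "l \<notin> C"
  then have "\<forall>\<^sub>F i in F. f i \<in> topspace X - C"
    using limitinD[OF assms(1), of "topspace X - C"] assms(1,3) unfolding limitin_def by blast
  with assms(4) have "\<forall>\<^sub>F i in F. False" by eventually_elim auto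
  then show False using assms(2) by simp
qed

text \<open>The order of the two limits matters: \<open>h\<close> is held fixed while \<open>i\<close> runs along \<open>F\<close>, and only then
does \<open>h\<close> run along \<open>E\<close>. This is the tensor product of the two filters, which is in general
strictly finer than their product.\<close>

definition iterated_filter :: "'h filter \<Rightarrow> 'i filter \<Rightarrow> ('h \<times> 'i) filter" where
  "iterated_filter E F = Abs_filter (\<lambda>P. \<forall>\<^sub>F h in E. \<forall>\<^sub>F i in F. P (h, i))"

lemma eventually_iterated_filter:
  "eventually P (iterated_filter E F) \<longleftrightarrow> (\<forall>\<^sub>F h in E. \<forall>\<^sub>F i in F. P (h, i))"
  unfolding iterated_filter_def
proof (rule eventually_Abs_filter, rule is_filter.intro)
  fix P Q :: "'a \<times> 'b \<Rightarrow> bool"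
  assume "\<forall>\<^sub>F h in E. \<forall>\<^sub>F i in F. P (h, i)"
  moreover assume "\<forall>\<^sub>F h in E. \<forall>\<^sub>F i in F. Q (h, i)"
  ultimately show "\<forall>\<^sub>F h in E. \<forall>\<^sub>F i in F. P (h, i) \<and> Q (h, i)"
    by eventually_elim (rule eventually_conj)
next
  fix P Q :: "'a \<times> 'b \<Rightarrow> bool"
  assume "\<forall>p. P p \<longrightarrow> Q p" and P: "\<forall>\<^sub>F h in E. \<forall>\<^sub>F i in F. P (h, i)"
  then show "\<forall>\<^sub>F h in E. \<forall>\<^sub>F i in F. Q (h, i)"
    by (auto elim!: eventually_mono)
qed simp

lemma ultra_iterated_filter:
  assumes "ultrafilter E" "ultrafilter F"
  shows "ultrafilter (iterated_filter E F)"
  unfolding ultrafilter_def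
proof (intro conjI allI)
  show "iterated_filter E F \<noteq> bot"
    using assms unfolding trivial_limit_def eventually_iterated_filter ultrafilter_def by simp
  fix P
  show "eventually P (iterated_filter E F) \<or> (\<forall>\<^sub>F p in iterated_filter E F. \<not> P p)"
    unfolding eventually_iterated_filter ultra_not_eventually[OF assms(2), symmetric]
    using ultra_not_eventually[OF assms(1), of "\<lambda>h. \<forall>\<^sub>F i in F. P (h, i)"] by blast
qed

lemma limitin_iterated_filter_snd:
  assumes "limitin X f l F"
  shows "limitin X (\<lambda>(h, i). f i) l (iterated_filter E F)"
  using assms unfolding limitin_def eventually_iterated_filter by simp

lemma limitin_iterated_filter:
  assumes "l \<in> topspace X" "\<forall>\<^sub>F h in E. limitin X (\<lambda>i. f (h, i)) l F"
  shows "limitin X f l (iterated_filter E F)"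
  unfolding limitin_def eventually_iterated_filter
proof (intro conjI allI impI assms(1))
  fix U assume "openin X U \<and> l \<in> U"
  then show "\<forall>\<^sub>F h in E. \<forall>\<^sub>F i in F. f (h, i) \<in> U"
    using assms(2) by (auto elim!: eventually_mono simp: limitin_def)
qed

lemma finite_if_all_equal:
  assumes "\<And>x y. x \<in> A \<Longrightarrow> y \<in> A \<Longrightarrow> x = y"
  shows "finite A"
proof (cases "A = {}")
  case False
  then obtain a where "a \<in> A" by blast
  then have "A \<subseteq> {a}" using assms by blast
  then show ?thesis by (rule finite_subset) simp
qed simp

section \<open>Relations without three disjoint pairs\<close>

text \<open>An instance of Koenig's theorem that a bipartite graph without three disjoint edges is covered by
two vertices. Totality on both sides and the presence of a third point exclude the covers by two
vertices on the same side. The relation is later the limit of the graphs of group elements, and the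
cover \<open>x = r \<or> y = s\<close> is its degeneration to the cross with centre \<open>(r, s)\<close>.\<close>

lemma cross_of_no_3_matching:
  assumes nomatch: "\<And>x1 x2 x3 y1 y2 y3. R x1 y1 \<Longrightarrow> R x2 y2 \<Longrightarrow> R x3 y3 \<Longrightarrow>
      x1 \<noteq> x2 \<Longrightarrow> x1 \<noteq> x3 \<Longrightarrow> x2 \<noteq> x3 \<Longrightarrow> y1 \<noteq> y2 \<Longrightarrow> y1 \<noteq> y3 \<Longrightarrow> y2 \<noteq> y3 \<Longrightarrow> False"
    and dom: "\<And>x y. R x y \<Longrightarrow> x \<in> Z \<and> y \<in> Z"
    and tot: "\<And>x. x \<in> Z \<Longrightarrow> \<exists>y. R x y"
    and surj: "\<And>y. y \<in> Z \<Longrightarrow> \<exists>x. R x y"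
    and three: "\<And>x y. \<exists>z\<in>Z. z \<noteq> x \<and> z \<noteq> y"
  shows "\<exists>r\<in>Z. \<exists>s\<in>Z. \<forall>x y. R x y \<longrightarrow> x = r \<or> y = s"
proof (cases "\<exists>x1 y1 x2 y2. R x1 y1 \<and> R x2 y2 \<and> x1 \<noteq> x2 \<and> y1 \<noteq> y2")
  case False
  obtain r s where "R r s" using three tot by blast
  then show ?thesis using False dom by blast
next
  case True
  then obtain a b a' b' where ab: "R a b" "R a' b'" "a \<noteq> a'" "b \<noteq> b'" by blast
  \<comment> \<open>A third row can only meet the columns of the two given pairs; number these so that it meets the second one.\<close>
  obtain x3 where x3: "x3 \<in> Z" "x3 \<noteq> a" "x3 \<noteq> a'" using three by blast
  then obtain y where y: "R x3 y" using tot by blast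
  then have "y = b \<or> y = b'" using nomatch[OF ab(1,2) y] ab x3 by blast
  then obtain x1 y1 x2 y2 where m: "R x1 y1" "R x2 y2" "x1 \<noteq> x2" "y1 \<noteq> y2"
    and r3: "R x3 y2" "x3 \<noteq> x1" "x3 \<noteq> x2"
    using ab x3 y by metis
  obtain y3 where y3: "y3 \<in> Z" "y3 \<noteq> y1" "y3 \<noteq> y2" using three by blast
  then obtain x where x: "R x y3" using surj by blast
  have "x = x1 \<or> x = x2" using nomatch[OF m(1,2) x] m y3 by blast
  moreover have "x \<noteq> x2" using nomatch[OF m(1) _ r3(1), of x y3] x m r3 y3 by blast
  ultimately have r1: "R x1 y3" using x by simp
  \<comment> \<open>Two of the four pairs found so far complete any pair off the cross to three disjoint pairs.\<close>
  have "x = x1 \<or> y = y2" if R: "R x y" for x y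
  proof (rule ccontr)
    assume n: "\<not> ?thesis"
    show False
    proof (cases "y = y1")
      case True
      show False
      proof (cases "x = x2")
        case True
        then show False using nomatch[OF R r1 r3(1)] n m r3 y3 \<open>y = y1\<close> by auto
      next
        case False
        then show False using nomatch[OF R r1 m(2)] n m r3 y3 \<open>y = y1\<close> by auto
      qed
    next
      case False
      show False
      proof (cases "x = x2")
        case True
        then show False using nomatch[OF m(1) R r3(1)] n m r3 y3 False by auto
      next
        case False
        then show False using nomatch[OF m(1,2) R] n m \<open>y \<noteq> y1\<close> by auto
      qed
    qed
  qed
  then show ?thesis using m dom by blast
qed

section \<open>Compact sets of three-element subsets\<close>

lemma compactin_transversal_triples:
  assumes "compactin X C1" "compactin X C2" "compactin X C3"
    and "C1 \<inter> C2 = {}" "C1 \<inter> C3 = {}" "C2 \<inter> C3 = {}"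
  shows "compactin (three_subsets X) {{x, y, z} | x y z. x \<in> C1 \<and> y \<in> C2 \<and> z \<in> C3}"
proof -
  let ?K = "C1 \<times> C2 \<times> C3"
  have "C1 \<subseteq> topspace X" "C2 \<subseteq> topspace X" "C3 \<subseteq> topspace X"
    using assms compactin_subset_topspace by blast+
  then have "?K \<subseteq> distinct_triples X"
    using assms(4-6) unfolding distinct_triples_def by blast
  then have "compactin (distinct_triples_topology X) ?K"
    using assms unfolding distinct_triples_topology_def
    by (simp add: compactin_subtopology compactin_Times)
  then have "compactin (three_subsets X) ((\<lambda>(x, y, z). {x, y, z}) ` ?K)"
    using quotient_map_three_subsets quotient_imp_continuous_map image_compactin by blast
  moreover have "(\<lambda>(x, y, z). {x, y, z}) ` ?K = {{x, y, z} | x y z. x \<in> C1 \<and> y \<in> C2 \<and> z \<in> C3}"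
    by force
  ultimately show ?thesis by simp
qed

lemma separating_closed_neighbourhoods3:
  assumes "compact_space X" "Hausdorff_space X"
    and "x \<in> topspace X" "y \<in> topspace X" "z \<in> topspace X" "x \<noteq> y" "x \<noteq> z" "y \<noteq> z"
  obtains U1 U2 U3 C1 C2 C3 where "openin X U1" "openin X U2" "openin X U3"
    "closedin X C1" "closedin X C2" "closedin X C3" "x \<in> U1" "y \<in> U2" "z \<in> U3"
    "U1 \<subseteq> C1" "U2 \<subseteq> C2" "U3 \<subseteq> C3"
    "C1 \<inter> C2 = {}" "C1 \<inter> C3 = {}" "C2 \<inter> C3 = {}"
proof -
  have "neighbourhood_base_of (closedin X) X"
    using assms(1,2) compact_Hausdorff_imp_regular_space neighbourhood_base_of_closedin by blast
  then have nhd: "\<exists>U C. openin X U \<and> closedin X C \<and> a \<in> U \<and> U \<subseteq> C \<and> C \<subseteq> Q"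
    if "openin X Q" "a \<in> Q" for a Q
    using that unfolding neighbourhood_base_of by blast
  have sep: "\<exists>P Q. openin X P \<and> openin X Q \<and> a \<in> P \<and> b \<in> Q \<and> P \<inter> Q = {}"
    if "a \<in> topspace X" "b \<in> topspace X" "a \<noteq> b" for a b
    using assms(2) that unfolding Hausdorff_space_def disjnt_def by blast
  obtain P1 Q1 where 1: "openin X P1" "openin X Q1" "x \<in> P1" "y \<in> Q1" "P1 \<inter> Q1 = {}"
    using sep[OF assms(3,4,6)] by blast
  obtain P2 Q2 where 2: "openin X P2" "openin X Q2" "x \<in> P2" "z \<in> Q2" "P2 \<inter> Q2 = {}"
    using sep[OF assms(3,5,7)] by blast
  obtain P3 Q3 where 3: "openin X P3" "openin X Q3" "y \<in> P3" "z \<in> Q3" "P3 \<inter> Q3 = {}"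
    using sep[OF assms(4,5,8)] by blast
  obtain U1 C1 where A: "openin X U1" "closedin X C1" "x \<in> U1" "U1 \<subseteq> C1" "C1 \<subseteq> P1 \<inter> P2"
    using nhd[OF openin_Int[OF 1(1) 2(1)] IntI[OF 1(3) 2(3)]] by (elim exE conjE)
  obtain U2 C2 where B: "openin X U2" "closedin X C2" "y \<in> U2" "U2 \<subseteq> C2" "C2 \<subseteq> Q1 \<inter> P3"
    using nhd[OF openin_Int[OF 1(2) 3(1)] IntI[OF 1(4) 3(3)]] by (elim exE conjE)
  obtain U3 C3 where C: "openin X U3" "closedin X C3" "z \<in> U3" "U3 \<subseteq> C3" "C3 \<subseteq> Q2 \<inter> Q3"
    using nhd[OF openin_Int[OF 2(2) 3(2)] IntI[OF 2(4) 3(4)]] by (elim exE conjE)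
  have "C1 \<inter> C2 = {}" "C1 \<inter> C3 = {}" "C2 \<inter> C3 = {}"
    using A(5) B(5) C(5) 1(5) 2(5) 3(5) by blast+
  then show thesis
    by (rule that[OF A(1) B(1) C(1) A(2) B(2) C(2) A(3) B(3) C(3) A(4) B(4) C(4)])
qed

section \<open>Three-discontinuous actions on compacta\<close>

locale three_discontinuous_group = group G for G (structure) +
  fixes X :: "'b topology" and \<phi> :: "'a \<Rightarrow> 'b \<Rightarrow> 'b"
  assumes compactum: "compactum X"
    and three_discontinuous: "three_discontinuous G X \<phi>"
begin

lemma compact_space_X [simp]: "compact_space X" and Hausdorff_space_X [simp]: "Hausdorff_space X"
  using compactum unfolding compactum_def by auto

sublocale action: group_action G "topspace X" \<phi>
  using three_discontinuous unfolding three_discontinuous_def acts_by_homeos_def by simp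

lemma act_in [simp]: "g \<in> carrier G \<Longrightarrow> x \<in> topspace X \<Longrightarrow> \<phi> g x \<in> topspace X"
  using action.element_image by blast

lemma act_mult: "g \<in> carrier G \<Longrightarrow> h \<in> carrier G \<Longrightarrow> x \<in> topspace X \<Longrightarrow> \<phi> (g \<otimes> h) x = \<phi> g (\<phi> h x)"
  using action.composition_rule by blast

lemma act_inv_act [simp]: "g \<in> carrier G \<Longrightarrow> x \<in> topspace X \<Longrightarrow> \<phi> (inv g) (\<phi> g x) = x"
  using action.orbit_sym_aux by blast

lemma act_act_inv [simp]: "g \<in> carrier G \<Longrightarrow> x \<in> topspace X \<Longrightarrow> \<phi> g (\<phi> (inv g) x) = x"
  using act_inv_act[of "inv g" x] by simp

lemma act_one [simp]: "x \<in> topspace X \<Longrightarrow> \<phi> \<one> x = x"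
  by (metis action.id_eq_one restrict_apply')

lemma homeo: "g \<in> carrier G \<Longrightarrow> homeomorphic_map X X (\<phi> g)"
  using three_discontinuous unfolding three_discontinuous_def acts_by_homeos_def by simp

lemma act_image_open: "g \<in> carrier G \<Longrightarrow> openin X U \<Longrightarrow> openin X (\<phi> g ` U)"
  using homeo homeomorphic_imp_open_map open_map_def by metis

lemma third_point: "\<exists>z\<in>topspace X. z \<noteq> x \<and> z \<noteq> y"
proof (rule ccontr)
  assume "\<not> ?thesis"
  then have *: "topspace X \<subseteq> {x, y}" by blast
  then have "finite (topspace X)" "card (topspace X) \<le> 2"
    using finite_subset[OF *] card_mono[OF _ *] by (auto simp: card_insert_if split: if_splits)
  then show False using compactum unfolding compactum_def by auto
qed

text \<open>Proper discontinuity in the form in which it is used: transversals of three disjoint closed sets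
form a compact set of triples.\<close>

lemma finite_moving_triples:
  assumes C: "closedin X C1" "closedin X C2" "closedin X C3"
      "C1 \<inter> C2 = {}" "C1 \<inter> C3 = {}" "C2 \<inter> C3 = {}"
    and D: "closedin X D1" "closedin X D2" "closedin X D3"
      "D1 \<inter> D2 = {}" "D1 \<inter> D3 = {}" "D2 \<inter> D3 = {}"
  shows "finite {g \<in> carrier G. \<phi> g ` C1 \<inter> D1 \<noteq> {} \<and> \<phi> g ` C2 \<inter> D2 \<noteq> {} \<and> \<phi> g ` C3 \<inter> D3 \<noteq> {}}"
proof -
  define P where "P C1 C2 C3 = {{x, y, z} | x y z. x \<in> C1 \<and> y \<in> C2 \<and> z \<in> C3}" for C1 C2 C3 :: "'b set"
  have P: "{x, y, z} \<in> P C1 C2 C3" if "x \<in> C1" "y \<in> C2" "z \<in> C3" for x y z C1 C2 C3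
    using that unfolding P_def by blast
  define K where "K = P C1 C2 C3 \<union> P D1 D2 D3"
  have "compactin (three_subsets X) (P C1 C2 C3)" "compactin (three_subsets X) (P D1 D2 D3)"
    unfolding P_def using assms
    by (simp_all add: compactin_transversal_triples closedin_compact_space)
  then have "compactin (three_subsets X) K"
    unfolding K_def by (rule compactin_Un)
  then have fin: "finite {g \<in> carrier G. (`) (\<phi> g) ` K \<inter> K \<noteq> {}}"
    using three_discontinuous unfolding three_discontinuous_def properly_discontinuous_def by blast
  have "(`) (\<phi> g) ` K \<inter> K \<noteq> {}"
    if m: "\<phi> g ` C1 \<inter> D1 \<noteq> {}" "\<phi> g ` C2 \<inter> D2 \<noteq> {}" "\<phi> g ` C3 \<inter> D3 \<noteq> {}" for g
  proof -
    obtain x y z where x: "x \<in> C1" "\<phi> g x \<in> D1" and y: "y \<in> C2" "\<phi> g y \<in> D2"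
      and z: "z \<in> C3" "\<phi> g z \<in> D3" using m by blast
    have "{x, y, z} \<in> K" "\<phi> g ` {x, y, z} \<in> K"
      using P[OF x(1) y(1) z(1)] P[OF x(2) y(2) z(2)] unfolding K_def by simp_all
    then show ?thesis by blast
  qed
  then show ?thesis using finite_subset[OF _ fin] by (simp add: subset_iff)
qed

text \<open>Locally uniform convergence of \<open>g\<close> to the constant \<open>s\<close> off the point \<open>r\<close>; \<open>s\<close> is the attractor
and \<open>r\<close> the repeller, and they may coincide.\<close>

definition collapses :: "'i filter \<Rightarrow> ('i \<Rightarrow> 'a) \<Rightarrow> 'b \<Rightarrow> 'b \<Rightarrow> bool" where
  "collapses F g r s \<longleftrightarrow> r \<in> topspace X \<and> s \<in> topspace X \<and>
     (\<forall>U W. openin X U \<and> r \<in> U \<and> openin X W \<and> s \<in> W \<longrightarrow>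
        (\<forall>\<^sub>F i in F. \<phi> (g i) ` (topspace X - U) \<subseteq> W))"

text \<open>The convergence property of three-discontinuous actions. The relation \<open>R\<close> below is the limit of the
graphs of the maps \<open>g i\<close>. Three pairs of \<open>R\<close> with distinct first and distinct second coordinates
would provide a compact set of triples that infinitely many group elements fail to move off itself.
Hence \<open>R\<close> lies in a cross \<open>x = r \<or> y = s\<close>; by compactness of \<open>X\<close>, any failure of uniform
convergence would leave a pair of \<open>R\<close> off this cross.\<close>

theorem ultra_collapses:
  assumes F: "ultrafilter F" and g: "\<forall>\<^sub>F i in F. g i \<in> carrier G"
    and nc: "\<And>c. \<forall>\<^sub>F i in F. g i \<noteq> c"
  obtains r s where "collapses F g r s"
proof -
  define R where "R x y \<longleftrightarrow> x \<in> topspace X \<and> y \<in> topspace X \<and>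
    (\<forall>U W. openin X U \<and> x \<in> U \<and> openin X W \<and> y \<in> W \<longrightarrow> (\<forall>\<^sub>F i in F. \<phi> (g i) ` U \<inter> W \<noteq> {}))" for x y
  have Fb: "F \<noteq> bot" using F unfolding ultrafilter_def by simp
  have lim: "R x y" if "limitin X u x F" "limitin X (\<lambda>i. \<phi> (g i) (u i)) y F" for u x y
  proof -
    have "\<forall>\<^sub>F i in F. \<phi> (g i) ` U \<inter> W \<noteq> {}"
      if "openin X U" "x \<in> U" "openin X W" "y \<in> W" for U W
    proof -
      have "\<forall>\<^sub>F i in F. u i \<in> U" "\<forall>\<^sub>F i in F. \<phi> (g i) (u i) \<in> W"
        using limitinD[OF \<open>limitin X u x F\<close>] limitinD[OF \<open>limitin X (\<lambda>i. \<phi> (g i) (u i)) y F\<close>] that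
        by simp_all
      then show ?thesis by eventually_elim blast
    qed
    moreover have "x \<in> topspace X" "y \<in> topspace X"
      using that limitin_topspace by metis+
    ultimately show ?thesis unfolding R_def by simp
  qed
  have "\<exists>r\<in>topspace X. \<exists>s\<in>topspace X. \<forall>x y. R x y \<longrightarrow> x = r \<or> y = s"
  proof (rule cross_of_no_3_matching)
    fix x1 x2 x3 y1 y2 y3
    assume R: "R x1 y1" "R x2 y2" "R x3 y3"
      and ne: "x1 \<noteq> x2" "x1 \<noteq> x3" "x2 \<noteq> x3" "y1 \<noteq> y2" "y1 \<noteq> y3" "y2 \<noteq> y3"
    have X: "x1 \<in> topspace X" "x2 \<in> topspace X" "x3 \<in> topspace X"
      "y1 \<in> topspace X" "y2 \<in> topspace X" "y3 \<in> topspace X"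
      using R unfolding R_def by auto
    obtain U1 U2 U3 C1 C2 C3 where U: "openin X U1" "openin X U2" "openin X U3"
      "x1 \<in> U1" "x2 \<in> U2" "x3 \<in> U3" "U1 \<subseteq> C1" "U2 \<subseteq> C2" "U3 \<subseteq> C3"
      and C: "closedin X C1" "closedin X C2" "closedin X C3"
      "C1 \<inter> C2 = {}" "C1 \<inter> C3 = {}" "C2 \<inter> C3 = {}"
      by (rule separating_closed_neighbourhoods3[OF compact_space_X Hausdorff_space_X X(1-3) ne(1-3)])
    obtain W1 W2 W3 D1 D2 D3 where W: "openin X W1" "openin X W2" "openin X W3"
      "y1 \<in> W1" "y2 \<in> W2" "y3 \<in> W3" "W1 \<subseteq> D1" "W2 \<subseteq> D2" "W3 \<subseteq> D3"
      and D: "closedin X D1" "closedin X D2" "closedin X D3"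
      "D1 \<inter> D2 = {}" "D1 \<inter> D3 = {}" "D2 \<inter> D3 = {}"
      by (rule separating_closed_neighbourhoods3[OF compact_space_X Hausdorff_space_X X(4-6) ne(4-6)])
    define B where "B = {c \<in> carrier G. \<phi> c ` C1 \<inter> D1 \<noteq> {} \<and> \<phi> c ` C2 \<inter> D2 \<noteq> {} \<and> \<phi> c ` C3 \<inter> D3 \<noteq> {}}"
    have "finite B"
      unfolding B_def by (rule finite_moving_triples[OF C D])
    then have "\<forall>\<^sub>F i in F. \<forall>c\<in>B. g i \<noteq> c"
      using nc by (subst eventually_ball_finite_distrib) auto
    moreover have "\<forall>\<^sub>F i in F. \<phi> (g i) ` U1 \<inter> W1 \<noteq> {}" "\<forall>\<^sub>F i in F. \<phi> (g i) ` U2 \<inter> W2 \<noteq> {}"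
      "\<forall>\<^sub>F i in F. \<phi> (g i) ` U3 \<inter> W3 \<noteq> {}"
      using R U(1-6) W(1-6) unfolding R_def by simp_all
    ultimately have "\<forall>\<^sub>F i in F. False"
      using g
    proof eventually_elim
      case (elim i)
      have "\<phi> (g i) ` C1 \<inter> D1 \<noteq> {}" using elim(2) U(7) W(7) by blast
      moreover have "\<phi> (g i) ` C2 \<inter> D2 \<noteq> {}" using elim(3) U(8) W(8) by blast
      moreover have "\<phi> (g i) ` C3 \<inter> D3 \<noteq> {}" using elim(4) U(9) W(9) by blast
      ultimately have "g i \<in> B" using elim(5) unfolding B_def by simp
      then show False using elim(1) by blast
    qed
    then show False using Fb by simp
  next
    fix x assume x: "x \<in> topspace X"
    have ev: "\<forall>\<^sub>F i in F. \<phi> (g i) x \<in> topspace X" using g by eventually_elim (use x in simp)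
    obtain y where "limitin X (\<lambda>i. \<phi> (g i) x) y F"
      by (rule ultra_limit_exists[OF compact_space_X F ev])
    moreover have "limitin X (\<lambda>_. x) x F" using x by simp
    ultimately show "\<exists>y. R x y" using lim by blast
  next
    fix y assume y: "y \<in> topspace X"
    have ev: "\<forall>\<^sub>F i in F. \<phi> (inv g i) y \<in> topspace X" using g by eventually_elim (use y in simp)
    obtain x where x: "limitin X (\<lambda>i. \<phi> (inv g i) y) x F"
      by (rule ultra_limit_exists[OF compact_space_X F ev])
    have "\<forall>\<^sub>F i in F. \<phi> (g i) (\<phi> (inv g i) y) = y" using g by eventually_elim (use y in simp)
    then have "limitin X (\<lambda>i. \<phi> (g i) (\<phi> (inv g i) y)) y F"
      using y unfolding limitin_def by (auto elim!: eventually_mono)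
    then show "\<exists>x. R x y" using lim[OF x] by blast
  next
    show "\<exists>z\<in>topspace X. z \<noteq> x \<and> z \<noteq> y" for x y by (rule third_point)
  qed (simp add: R_def)
  then obtain r s where rs: "r \<in> topspace X" "s \<in> topspace X" "\<And>x y. R x y \<Longrightarrow> x = r \<or> y = s"
    by blast
  have "\<forall>\<^sub>F i in F. \<phi> (g i) ` (topspace X - U) \<subseteq> W"
    if UW: "openin X U" "r \<in> U" "openin X W" "s \<in> W" for U W
  proof (rule ccontr)
    assume "\<not> ?thesis"
    then have "\<forall>\<^sub>F i in F. \<exists>u. u \<in> topspace X - U \<and> \<phi> (g i) u \<notin> W"
      unfolding ultra_not_eventually[OF F] by (simp add: image_subset_iff Bex_def)
    then obtain u where u: "\<forall>\<^sub>F i in F. u i \<in> topspace X - U \<and> \<phi> (g i) (u i) \<notin> W"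
      unfolding eventually_ex by auto
    have u1: "\<forall>\<^sub>F i in F. u i \<in> topspace X - U" using u by eventually_elim simp
    have u2: "\<forall>\<^sub>F i in F. \<phi> (g i) (u i) \<in> topspace X - W" using u g by eventually_elim simp
    have u1': "\<forall>\<^sub>F i in F. u i \<in> topspace X" using u1 by eventually_elim simp
    have u2': "\<forall>\<^sub>F i in F. \<phi> (g i) (u i) \<in> topspace X" using u2 by eventually_elim simp
    obtain x where x: "limitin X u x F"
      by (rule ultra_limit_exists[OF compact_space_X F u1'])
    obtain y where y: "limitin X (\<lambda>i. \<phi> (g i) (u i)) y F"
      by (rule ultra_limit_exists[OF compact_space_X F u2'])
    have "x \<in> topspace X - U" by (rule limitin_closed_mem[OF x Fb _ u1]) (use UW in auto)
    moreover have "y \<in> topspace X - W" by (rule limitin_closed_mem[OF y Fb _ u2]) (use UW in auto)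
    ultimately show False using rs(3)[OF lim[OF x y]] UW(2,4) by auto
  qed
  then have "collapses F g r s" unfolding collapses_def using rs(1,2) by simp
  then show thesis by (rule that)
qed

lemma disjoint_open_neighbourhoods:
  assumes "x \<in> topspace X" "y \<in> topspace X" "x \<noteq> y"
  obtains U V where "openin X U" "openin X V" "x \<in> U" "y \<in> V" "U \<inter> V = {}"
proof -
  have "\<exists>U V. openin X U \<and> openin X V \<and> x \<in> U \<and> y \<in> V \<and> U \<inter> V = {}"
    using Hausdorff_space_X assms unfolding Hausdorff_space_def disjnt_def by simp
  then show thesis by (elim exE conjE) (rule that)
qed

lemma collapsesD:
  "collapses F g r s \<Longrightarrow> openin X U \<Longrightarrow> r \<in> U \<Longrightarrow> openin X W \<Longrightarrow> s \<in> W \<Longrightarrow>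
     \<forall>\<^sub>F i in F. \<phi> (g i) ` (topspace X - U) \<subseteq> W"
  unfolding collapses_def by simp

lemma collapses_in_space:
  assumes "collapses F g r s"
  shows "r \<in> topspace X" "s \<in> topspace X"
  using assms unfolding collapses_def by simp_all

lemma collapses_limitin:
  assumes col: "collapses F g r s" and u: "limitin X u x F" and "x \<noteq> r"
  shows "limitin X (\<lambda>i. \<phi> (g i) (u i)) s F"
  unfolding limitin_def
proof (intro conjI allI impI)
  show "s \<in> topspace X" using col by (rule collapses_in_space)
  fix W assume W: "openin X W \<and> s \<in> W"
  obtain U V where UV: "openin X U" "openin X V" "r \<in> U" "x \<in> V" "U \<inter> V = {}"
    using disjoint_open_neighbourhoods[of r x] collapses_in_space[OF col] limitin_topspace[OF u] \<open>x \<noteq> r\<close>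
    by metis
  have "\<forall>\<^sub>F i in F. \<phi> (g i) ` (topspace X - U) \<subseteq> W"
    using collapsesD[OF col UV(1,3)] W by simp
  moreover have "\<forall>\<^sub>F i in F. u i \<in> V"
    using limitinD[OF u UV(2,4)] .
  ultimately show "\<forall>\<^sub>F i in F. \<phi> (g i) (u i) \<in> W"
  proof eventually_elim
    case (elim i)
    then have "u i \<in> topspace X - U" using UV(5) openin_subset[OF UV(2)] by blast
    then show ?case using elim(1) by blast
  qed
qed

lemma collapses_pointwise:
  assumes "collapses F g r s" "x \<in> topspace X" "x \<noteq> r"
  shows "limitin X (\<lambda>i. \<phi> (g i) x) s F"
  using collapses_limitin[OF assms(1) _ assms(3), of "\<lambda>_. x"] assms(2) by simp

text \<open>The test that locates attractors and repellers: a pair of limits of moving points and their images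
lies on the cross.\<close>

lemma collapses_moving_limits:
  assumes "collapses F g r s" "F \<noteq> bot" "limitin X u x F" "limitin X (\<lambda>i. \<phi> (g i) (u i)) y F"
  shows "x = r \<or> y = s"
proof (rule disjCI)
  assume "y \<noteq> s"
  show "x = r"
  proof (rule ccontr)
    assume "x \<noteq> r"
    from collapses_limitin[OF assms(1,3) this] have "s = y"
      by (rule limitin_Hausdorff_unique[OF _ assms(4,2) Hausdorff_space_X])
    then show False using \<open>y \<noteq> s\<close> by simp
  qed
qed

lemma act_complement_swap:
  assumes "g \<in> carrier G" "\<phi> g ` (topspace X - U) \<subseteq> W"
  shows "\<phi> (inv g) ` (topspace X - W) \<subseteq> U"
proof
  fix y assume "y \<in> \<phi> (inv g) ` (topspace X - W)"
  then obtain x where x: "x \<in> topspace X" "x \<notin> W" "y = \<phi> (inv g) x" by blast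
  then have "y \<in> topspace X" "\<phi> g y = x" using assms(1) by simp_all
  then show "y \<in> U" using assms(2) x by blast
qed

lemma collapses_inverse:
  assumes col: "collapses F g r s" and g: "\<forall>\<^sub>F i in F. g i \<in> carrier G"
  shows "collapses F (\<lambda>i. inv (g i)) s r"
proof -
  have "\<forall>\<^sub>F i in F. \<phi> (inv (g i)) ` (topspace X - W) \<subseteq> U"
    if "openin X U" "r \<in> U" "openin X W" "s \<in> W" for U W
    using collapsesD[OF col that] g by eventually_elim (rule act_complement_swap)
  then show ?thesis using collapses_in_space[OF col] unfolding collapses_def by simp
qed

section \<open>Limit sets and accumulation of orbits\<close>

lemma limit_set_subset: "limit_set H X \<phi> \<subseteq> topspace X"
  unfolding limit_set_def by blast

lemma not_in_limit_set_iff: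
  "x \<in> topspace X \<Longrightarrow> x \<notin> limit_set H X \<phi> \<longleftrightarrow>
    (\<exists>U. openin X U \<and> x \<in> U \<and> finite {h \<in> H. \<phi> h ` U \<inter> U \<noteq> {}})"
  unfolding limit_set_def by blast

lemma closedin_limit_set: "closedin X (limit_set H X \<phi>)"
proof -
  let ?D = "{x \<in> topspace X. \<exists>U. openin X U \<and> x \<in> U \<and> finite {h \<in> H. \<phi> h ` U \<inter> U \<noteq> {}}}"
  have "openin X ?D"
  proof (subst openin_subopen, safe)
    fix x U assume "openin X U" "x \<in> U" "finite {h \<in> H. \<phi> h ` U \<inter> U \<noteq> {}}"
    then show "\<exists>T. openin X T \<and> x \<in> T \<and> T \<subseteq> ?D" using openin_subset by blast
  qed
  then show ?thesis unfolding limit_set_def by blast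
qed

lemma limit_set_mono:
  assumes "H \<subseteq> H'"
  shows "limit_set H X \<phi> \<subseteq> limit_set H' X \<phi>"
proof -
  have "finite {h \<in> H. \<phi> h ` U \<inter> U \<noteq> {}}" if "finite {h \<in> H'. \<phi> h ` U \<inter> U \<noteq> {}}" for U
    using that by (rule rev_finite_subset) (use assms in blast)
  then show ?thesis unfolding limit_set_def by (intro Diff_mono) auto
qed

lemma limit_set_invariant:
  assumes H: "subgroup H G" and h: "h \<in> H" and x: "x \<in> limit_set H X \<phi>"
  shows "\<phi> h x \<in> limit_set H X \<phi>"
proof (rule ccontr)
  interpret H: subgroup H G by (rule H)
  have hG: "h \<in> carrier G" using h H.subset by blast
  have xX: "x \<in> topspace X" using x limit_set_subset by blast
  assume "\<phi> h x \<notin> limit_set H X \<phi>"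
  then obtain U where U: "openin X U" "\<phi> h x \<in> U" "finite {k \<in> H. \<phi> k ` U \<inter> U \<noteq> {}}"
    using not_in_limit_set_iff[OF act_in[OF hG xX]] by auto
  let ?V = "\<phi> (inv h) ` U"
  have "openin X ?V" using act_image_open U(1) hG by simp
  moreover have "x \<in> ?V" using U(2) act_inv_act[OF hG xX] by (metis imageI)
  moreover have "{k \<in> H. \<phi> k ` ?V \<inter> ?V \<noteq> {}} \<subseteq> (\<lambda>k. inv h \<otimes> k \<otimes> h) ` {k \<in> H. \<phi> k ` U \<inter> U \<noteq> {}}"
  proof
    fix k assume "k \<in> {k \<in> H. \<phi> k ` ?V \<inter> ?V \<noteq> {}}"
    then obtain u w where k: "k \<in> H" and uw: "u \<in> U" "w \<in> U" "\<phi> k (\<phi> (inv h) u) = \<phi> (inv h) w"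
      by blast
    have uwX: "u \<in> topspace X" "w \<in> topspace X" using uw U(1) openin_subset by blast+
    have kG: "k \<in> carrier G" using k H.subset by blast
    let ?l = "h \<otimes> k \<otimes> inv h"
    have "?l \<in> H" using h k by simp
    moreover have "\<phi> ?l u = w" using uw uwX hG kG by (simp add: act_mult)
    then have "w \<in> \<phi> ?l ` U \<inter> U" using uw(1,2) by blast
    ultimately have l: "?l \<in> {k \<in> H. \<phi> k ` U \<inter> U \<noteq> {}}" by blast
    have "inv h \<otimes> ?l \<otimes> h = (inv h \<otimes> h) \<otimes> k \<otimes> (inv h \<otimes> h)"
      using hG kG by (simp only: m_assoc m_closed inv_closed)
    then have "k = inv h \<otimes> ?l \<otimes> h" using hG kG by simp
    then show "k \<in> (\<lambda>k. inv h \<otimes> k \<otimes> h) ` {k \<in> H. \<phi> k ` U \<inter> U \<noteq> {}}"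
      using l by (rule image_eqI)
  qed
  then have "finite {k \<in> H. \<phi> k ` ?V \<inter> ?V \<noteq> {}}" by (rule finite_subset) (simp add: U(3))
  ultimately have "x \<notin> limit_set H X \<phi>"
    unfolding not_in_limit_set_iff[OF xX] by (intro exI[of _ ?V] conjI)
  then show False using x by simp
qed

text \<open>If \<open>k x\<close> and \<open>h x\<close> both lie in \<open>U\<close>, then \<open>h k\<inverse>\<close> returns \<open>U\<close> to itself; fix \<open>k\<close> and vary \<open>h\<close>.\<close>

lemma infinite_returns_of_infinite_visits:
  assumes H: "subgroup H G" and x: "x \<in> topspace X" and inf: "infinite {h \<in> H. \<phi> h x \<in> U}"
  shows "infinite {h \<in> H. \<phi> h ` U \<inter> U \<noteq> {}}"
proof
  interpret H: subgroup H G by (rule H)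
  assume fin: "finite {h \<in> H. \<phi> h ` U \<inter> U \<noteq> {}}"
  obtain k where k: "k \<in> H" "\<phi> k x \<in> U" using inf by (metis (mono_tags, lifting) Collect_empty_eq finite.emptyI)
  have kG: "k \<in> carrier G" using k H.subset by blast
  have "{h \<in> H. \<phi> h x \<in> U} \<subseteq> (\<lambda>l. l \<otimes> k) ` {h \<in> H. \<phi> h ` U \<inter> U \<noteq> {}}"
  proof
    fix h assume h: "h \<in> {h \<in> H. \<phi> h x \<in> U}"
    then have hG: "h \<in> carrier G" using H.subset by blast
    have "\<phi> (h \<otimes> inv k) (\<phi> k x) = \<phi> h x" using hG kG x by (simp add: act_mult)
    then have "\<phi> h x \<in> \<phi> (h \<otimes> inv k) ` U \<inter> U" using h k(2) by (metis (mono_tags, lifting) IntI imageI mem_Collect_eq)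
    moreover have "h \<otimes> inv k \<in> H" using h k by simp
    ultimately have l: "h \<otimes> inv k \<in> {h \<in> H. \<phi> h ` U \<inter> U \<noteq> {}}" by blast
    have "h = h \<otimes> inv k \<otimes> k" using hG kG by (simp add: m_assoc)
    then show "h \<in> (\<lambda>l. l \<otimes> k) ` {h \<in> H. \<phi> h ` U \<inter> U \<noteq> {}}" using l by (rule image_eqI)
  qed
  then have "finite {h \<in> H. \<phi> h x \<in> U}" by (rule finite_subset) (simp add: fin)
  then show False using inf by simp
qed

text \<open>Infinitely many visits to a compact set accumulate somewhere in it: otherwise finitely many open sets
with finitely many returns would cover it.\<close>

lemma limit_set_meets_closed:
  assumes H: "subgroup H G" and x: "x \<in> topspace X" and C: "closedin X C"
    and inf: "infinite {h \<in> H. \<phi> h x \<in> C}"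
  shows "limit_set H X \<phi> \<inter> C \<noteq> {}"
proof
  assume no: "limit_set H X \<phi> \<inter> C = {}"
  let ?\<W> = "{W. openin X W \<and> finite {h \<in> H. \<phi> h ` W \<inter> W \<noteq> {}}}"
  have "C \<subseteq> \<Union>?\<W>"
  proof
    fix c assume c: "c \<in> C"
    then have "c \<in> topspace X" "c \<notin> limit_set H X \<phi>" using closedin_subset[OF C] no by blast+
    then show "c \<in> \<Union>?\<W>" using not_in_limit_set_iff by auto
  qed
  then have "\<exists>\<F>. finite \<F> \<and> \<F> \<subseteq> ?\<W> \<and> C \<subseteq> \<Union>\<F>"
    by (intro compactinD[OF closedin_compact_space[OF compact_space_X C]]) simp_all
  then obtain \<F> where \<F>: "finite \<F>" "\<F> \<subseteq> ?\<W>" "C \<subseteq> \<Union>\<F>" by (elim exE conjE)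
  have "finite {h \<in> H. \<phi> h x \<in> W}" if "W \<in> \<F>" for W
    using infinite_returns_of_infinite_visits[OF H x, of W] subsetD[OF \<F>(2) that] by auto
  then have "finite (\<Union>W\<in>\<F>. {h \<in> H. \<phi> h x \<in> W})" using \<F>(1) by simp
  then have "finite {h \<in> H. \<phi> h x \<in> C}" by (rule rev_finite_subset) (use \<F>(3) in blast)
  then show False using inf by simp
qed

text \<open>Any point other than the repeller has orbit points accumulating at the attractor.\<close>

lemma attractor_in_limit_set:
  assumes H: "subgroup H G" and col: "collapses F g r s" and Fb: "F \<noteq> bot"
    and g: "\<forall>\<^sub>F i in F. g i \<in> H" and nc: "\<And>c. \<forall>\<^sub>F i in F. g i \<noteq> c"
  shows "s \<in> limit_set H X \<phi>"
proof (rule ccontr)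
  assume "s \<notin> limit_set H X \<phi>"
  then obtain U where U: "openin X U" "s \<in> U" "finite {h \<in> H. \<phi> h ` U \<inter> U \<noteq> {}}"
    using not_in_limit_set_iff[OF collapses_in_space(2)[OF col]] by auto
  obtain x where x: "x \<in> topspace X" "x \<noteq> r" using third_point by blast
  have fin: "finite {h \<in> H. \<phi> h x \<in> U}"
    using infinite_returns_of_infinite_visits[OF H x(1), of U] U(3) by auto
  have "limitin X (\<lambda>i. \<phi> (g i) x) s F"
    using collapses_limitin[OF col _ x(2)] x(1) by simp
  then have "\<forall>\<^sub>F i in F. \<phi> (g i) x \<in> U" using limitinD U(1,2) by metis
  moreover have "\<forall>\<^sub>F i in F. \<forall>c\<in>{h \<in> H. \<phi> h x \<in> U}. g i \<noteq> c"
    using nc fin by (subst eventually_ball_finite_distrib) auto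
  ultimately have "\<forall>\<^sub>F i in F. False"
    using g
  proof eventually_elim
    case (elim i)
    then have "g i \<in> {h \<in> H. \<phi> h x \<in> U}" by simp
    from bspec[OF elim(2) this] show False by simp
  qed
  then show False using Fb by simp
qed

text \<open>The inverse of \<open>h\<close> maps the complement of \<open>N2\<close> into \<open>N1\<close>. So all its positive powers carry
\<open>z\<close> into \<open>N1\<close>; as \<open>z\<close> itself is not there, they are pairwise distinct, and their orbit points accumulate outside \<open>N2\<close>.\<close>

lemma ping_pong_escapes:
  assumes H: "subgroup H G" and h: "h \<in> H" and N: "openin X N1" "openin X N2" "N1 \<inter> N2 = {}"
    and z: "z \<in> topspace X" "z \<notin> N1" "z \<notin> N2"
    and maps: "\<phi> h ` (topspace X - N1) \<subseteq> N2"
  shows "\<not> limit_set H X \<phi> \<subseteq> N2"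
proof -
  interpret H: subgroup H G by (rule H)
  have hG: "h \<in> carrier G" using h H.subset by blast
  define k where "k = inv h"
  have k: "k \<in> H" "k \<in> carrier G" using h hG unfolding k_def by simp_all
  have swap: "\<phi> k ` (topspace X - N2) \<subseteq> N1"
    unfolding k_def by (rule act_complement_swap[OF hG maps])
  have pow: "\<phi> (k [^] Suc n) z \<in> N1" for n
  proof (induction n)
    case 0
    then show ?case using swap z k by auto
  next
    case (Suc n)
    let ?y = "\<phi> (k [^] Suc n) z"
    have "k [^] Suc (Suc n) = k \<otimes> k [^] Suc n" using k(2) nat_pow_Suc2 by blast
    then have "\<phi> (k [^] Suc (Suc n)) z = \<phi> k ?y" using act_mult k(2) z(1) nat_pow_closed by metis
    moreover have "?y \<in> topspace X - N2" using Suc N(3) openin_subset[OF N(1)] by blast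
    ultimately show ?case using swap by (simp add: image_subset_iff)
  qed
  have ne: "k [^] m \<noteq> k [^] n" if "n < m" for m n :: nat
  proof
    assume "k [^] m = k [^] n"
    then have "k [^] (m - n) = \<one>" by (rule pow_eq_div2[OF k(2)])
    moreover have "m - n = Suc (m - Suc n)" using that by simp
    ultimately have "\<phi> \<one> z \<in> N1" using pow[of "m - Suc n"] by (simp only:)
    then show False using z by simp
  qed
  have "inj (\<lambda>n::nat. k [^] Suc n)"
  proof (rule injI)
    fix m n :: nat assume "k [^] Suc m = k [^] Suc n"
    then show "m = n" using ne[of "Suc m" "Suc n"] ne[of "Suc n" "Suc m"]
      by (metis Suc_less_eq linorder_neqE_nat)
  qed
  then have "infinite (range (\<lambda>n::nat. k [^] Suc n))" using range_inj_infinite by blast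
  moreover have mem: "k [^] n \<in> H" for n :: nat
    by (induction n) (use k in simp_all)
  have "k [^] Suc n \<in> {l \<in> H. \<phi> l z \<in> topspace X - N2}" for n :: nat
    using pow[of n] mem[of "Suc n"] N(3) openin_subset[OF N(1)] by (simp only: mem_Collect_eq) blast
  then have "range (\<lambda>n::nat. k [^] Suc n) \<subseteq> {l \<in> H. \<phi> l z \<in> topspace X - N2}"
    by (rule image_subsetI)
  ultimately have inf: "infinite {l \<in> H. \<phi> l z \<in> topspace X - N2}" by (meson finite_subset)
  have "limit_set H X \<phi> \<inter> (topspace X - N2) \<noteq> {}"
    by (rule limit_set_meets_closed[OF H z(1) closedin_diff[OF closedin_topspace N(2)] inf])
  then show ?thesis by blast
qed

section \<open>A single limit point is not conical\<close>

lemma limit_set_infinite: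
  assumes "x \<in> limit_set H X \<phi>"
  shows "infinite H"
proof
  assume "finite H"
  then have "\<exists>U. openin X U \<and> x \<in> U \<and> finite {h \<in> H. \<phi> h ` U \<inter> U \<noteq> {}}"
    using assms limit_set_subset by (intro exI[of _ "topspace X"]) auto
  then show False using assms unfolding limit_set_def by simp
qed

text \<open>A point \<open>s\<close> with these maps \<open>\<gamma>\<close> is a conical limit point: \<open>\<gamma>\<close> pulls all other points to \<open>v\<close> but
keeps \<open>s\<close> away from \<open>v\<close>. Consider the conjugates \<open>d = \<gamma> h \<gamma>\<inverse>\<close>, for \<open>h\<close> in \<open>H\<close>. They fix \<open>\<gamma> s\<close>,
which tends to \<open>p\<close>. For \<open>y \<noteq> s\<close> they move \<open>\<gamma> y\<close> to \<open>\<gamma> (h y)\<close>, and both of these tend to \<open>v\<close> as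
long as \<open>h\<close> is held fixed. Along the iterated filter the \<open>d\<close> collapse, and these two observations
identify the attractor and the repeller with \<open>p\<close> and \<open>v\<close> in some order. So some conjugate, or its
inverse, maps the complement of a neighbourhood of \<open>v\<close> into a neighbourhood of \<open>p\<close> that contains
\<open>\<gamma> s\<close>. Conjugated back, an element of \<open>H\<close> plays ping-pong with the whole limit set on one side.\<close>

lemma unique_limit_point_not_conical:
  assumes H: "subgroup H G" and lim: "limit_set H X \<phi> = {s}"
    and F: "ultrafilter F" and \<gamma>: "\<forall>\<^sub>F i in F. \<gamma> i \<in> carrier G"
    and col: "collapses F \<gamma> s v" and p: "limitin X (\<lambda>i. \<phi> (\<gamma> i) s) p F" and "p \<noteq> v"
  shows False
proof -
  interpret H: subgroup H G by (rule H)
  have HG: "h \<in> carrier G" if "h \<in> H" for h using that H.subset by blast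
  have Fb: "F \<noteq> bot" using F unfolding ultrafilter_def by simp
  have sX: "s \<in> topspace X" and vX: "v \<in> topspace X" using collapses_in_space[OF col] .
  have pX: "p \<in> topspace X" using p by (rule limitin_topspace)
  have fix_s: "\<phi> h s = s" if "h \<in> H" for h
    using limit_set_invariant[OF H that, of s] lim by simp
  have "infinite H" using limit_set_infinite[of s H] lim by simp
  then obtain E where E: "ultrafilter E" "\<forall>\<^sub>F h in E. h \<in> H" "\<forall>B. finite B \<longrightarrow> (\<forall>\<^sub>F h in E. h \<notin> B)"
    by (rule ultra_on_infinite_set)
  define D where "D = iterated_filter E F"
  define d where "d = (\<lambda>(h, i). \<gamma> i \<otimes> h \<otimes> inv (\<gamma> i))"
  have D: "ultrafilter D" unfolding D_def by (rule ultra_iterated_filter[OF E(1) F])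
  have Db: "D \<noteq> bot" using D unfolding ultrafilter_def by simp
  have mem: "\<forall>\<^sub>F q in D. fst q \<in> H \<and> \<gamma> (snd q) \<in> carrier G"
    unfolding D_def eventually_iterated_filter using E(2)
    by eventually_elim (use \<gamma> in simp)
  have dG: "\<forall>\<^sub>F q in D. d q \<in> carrier G"
    using mem by eventually_elim (auto simp: d_def HG split: prod.split)
  \<comment> \<open>For fixed \<open>i\<close>, conjugation is injective; so at most one \<open>h\<close> has \<open>d (h, i) = c\<close> for most \<open>i\<close>.\<close>
  have d_nc: "\<forall>\<^sub>F q in D. d q \<noteq> c" for c
  proof -
    have "finite {h \<in> H. \<not> (\<forall>\<^sub>F i in F. d (h, i) \<noteq> c)}"
    proof (rule finite_if_all_equal)
      fix h h'
      assume "h \<in> {h \<in> H. \<not> (\<forall>\<^sub>F i in F. d (h, i) \<noteq> c)}" "h' \<in> {h \<in> H. \<not> (\<forall>\<^sub>F i in F. d (h, i) \<noteq> c)}"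
      then have h: "h \<in> H" "h' \<in> H" "\<forall>\<^sub>F i in F. d (h, i) = c" "\<forall>\<^sub>F i in F. d (h', i) = c"
        unfolding ultra_not_eventually[OF F] by simp_all
      have "\<forall>\<^sub>F i in F. h = h'"
        using h(3,4) \<gamma>
      proof eventually_elim
        case (elim i)
        then have "\<gamma> i \<otimes> h \<otimes> inv (\<gamma> i) = \<gamma> i \<otimes> h' \<otimes> inv (\<gamma> i)" unfolding d_def by simp
        then show ?case using elim(3) HG h(1,2) by simp
      qed
      then show "h = h'" using Fb by simp
    qed
    from E(3)[rule_format, OF this] show ?thesis
      unfolding D_def eventually_iterated_filter using E(2) by eventually_elim simp
  qed
  obtain r q where rq: "collapses D d r q" by (rule ultra_collapses[OF D dG d_nc])
  have pD: "limitin X (\<lambda>(h, i). \<phi> (\<gamma> i) s) p D"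
    unfolding D_def by (rule limitin_iterated_filter_snd[OF p])
  have fix_p: "\<forall>\<^sub>F x in D. \<phi> (d x) (case x of (h, i) \<Rightarrow> \<phi> (\<gamma> i) s) = (case x of (h, i) \<Rightarrow> \<phi> (\<gamma> i) s)"
    using mem by eventually_elim (auto simp: d_def act_mult HG sX fix_s split: prod.split)
  have "limitin X (\<lambda>x. \<phi> (d x) (case x of (h, i) \<Rightarrow> \<phi> (\<gamma> i) s)) p D"
    using limitin_transform_eventually[OF _ pD] fix_p by (simp add: eq_commute)
  then have p_rq: "p = r \<or> p = q" by (rule collapses_moving_limits[OF rq Db pD])
  obtain y where y: "y \<in> topspace X" "y \<noteq> s" using third_point by blast
  have lim_v: "limitin X (\<lambda>i. \<phi> (\<gamma> i) x) v F" if "x \<in> topspace X" "x \<noteq> s" for x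
    by (rule collapses_pointwise[OF col that])
  have yD: "limitin X (\<lambda>(h, i). \<phi> (\<gamma> i) y) v D"
    unfolding D_def by (rule limitin_iterated_filter_snd[OF lim_v[OF y]])
  have "limitin X (\<lambda>x. \<phi> (d x) (case x of (h, i) \<Rightarrow> \<phi> (\<gamma> i) y)) v D"
    unfolding D_def
  proof (rule limitin_iterated_filter[OF vX])
    show "\<forall>\<^sub>F h in E. limitin X (\<lambda>i. \<phi> (d (h, i)) (case (h, i) of (h, i) \<Rightarrow> \<phi> (\<gamma> i) y)) v F"
      using E(2)
    proof eventually_elim
      case (elim h)
      have "\<phi> h y \<noteq> s"
        using act_inv_act[OF HG[OF elim] y(1)] fix_s[of "inv h"] y(2) elim by auto
      then have l: "limitin X (\<lambda>i. \<phi> (\<gamma> i) (\<phi> h y)) v F"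
        using lim_v HG[OF elim] y(1) by simp
      have "\<forall>\<^sub>F i in F. \<phi> (\<gamma> i) (\<phi> h y) = \<phi> (d (h, i)) (case (h, i) of (h, i) \<Rightarrow> \<phi> (\<gamma> i) y)"
        using \<gamma> by eventually_elim (simp add: d_def act_mult HG[OF elim] y(1))
      from limitin_transform_eventually[OF this l] show ?case .
    qed
  qed
  then have v_rq: "v = r \<or> v = q" by (rule collapses_moving_limits[OF rq Db yD])
  \<comment> \<open>A point outside both neighbourhoods makes the ping-pong proper, as \<open>ping_pong_escapes\<close> requires.\<close>
  obtain z where z: "z \<in> topspace X" "z \<noteq> p" "z \<noteq> v" using third_point by blast
  obtain Np Nv Nz C1 C2 C3 where N: "openin X Np" "openin X Nv" "openin X Nz"
    "closedin X C1" "closedin X C2" "closedin X C3" "p \<in> Np" "v \<in> Nv" "z \<in> Nz"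
    "Np \<subseteq> C1" "Nv \<subseteq> C2" "Nz \<subseteq> C3" "C1 \<inter> C2 = {}" "C1 \<inter> C3 = {}" "C2 \<inter> C3 = {}"
    by (rule separating_closed_neighbourhoods3[OF compact_space_X Hausdorff_space_X pX vX z(1) \<open>p \<noteq> v\<close> z(2,3)[symmetric]])
  have disj: "Nv \<inter> Np = {}" "z \<notin> Nv" "z \<notin> Np" using N(7-15) by blast+
  have "\<forall>\<^sub>F x in D. \<phi> (d x) ` (topspace X - Nv) \<subseteq> Np \<or> \<phi> (d x) ` (topspace X - Np) \<subseteq> Nv"
  proof -
    have "r = v \<and> q = p \<or> r = p \<and> q = v" using p_rq v_rq \<open>p \<noteq> v\<close> by auto
    then show ?thesis
    proof
      assume "r = v \<and> q = p"
      then show ?thesis using collapsesD[OF rq N(2) _ N(1)] N(7,8) by (auto elim: eventually_mono)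
    next
      assume "r = p \<and> q = v"
      then show ?thesis using collapsesD[OF rq N(1) _ N(2)] N(7,8) by (auto elim: eventually_mono)
    qed
  qed
  moreover have "\<forall>\<^sub>F x in D. (case x of (h, i) \<Rightarrow> \<phi> (\<gamma> i) s) \<in> Np"
    using limitinD[OF pD N(1,7)] .
  ultimately have "\<forall>\<^sub>F x in D. False"
    using mem
  proof eventually_elim
    case (elim x)
    obtain h i where x: "x = (h, i)" by (cases x)
    have h: "h \<in> H" "h \<in> carrier G" and g: "\<gamma> i \<in> carrier G" using elim(3) HG unfolding x by simp_all
    define c where "c = \<gamma> i"
    have c: "c \<in> carrier G" unfolding c_def by (rule g)
    have s_in: "\<phi> c s \<in> Np" using elim(2) unfolding x c_def by simp
    \<comment> \<open>If \<open>p\<close> is the repeller, the inverse of the conjugate has the wanted direction.\<close>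
    obtain k where k: "k \<in> H" "\<phi> (c \<otimes> k \<otimes> inv c) ` (topspace X - Nv) \<subseteq> Np"
    proof -
      have dG: "c \<otimes> h \<otimes> inv c \<in> carrier G" using c h by simp
      consider "\<phi> (c \<otimes> h \<otimes> inv c) ` (topspace X - Nv) \<subseteq> Np" | "\<phi> (c \<otimes> h \<otimes> inv c) ` (topspace X - Np) \<subseteq> Nv"
        using elim(1) unfolding x d_def c_def by auto
      then show thesis
      proof cases
        case 1
        then show thesis using that h by simp
      next
        case 2
        have "inv (c \<otimes> h \<otimes> inv c) = c \<otimes> inv h \<otimes> inv c"
          using c h by (simp add: inv_mult_group m_assoc)
        then show thesis using that[of "inv h"] act_complement_swap[OF dG 2] h by simp
      qed
    qed
    have kG: "k \<in> carrier G" by (rule HG[OF k(1)])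
    let ?N1 = "\<phi> (inv c) ` Nv" and ?N2 = "\<phi> (inv c) ` Np"
    have sub: "Nv \<subseteq> topspace X" "Np \<subseteq> topspace X" using openin_subset[OF N(2)] openin_subset[OF N(1)] .
    have mem_iff: "w \<in> \<phi> (inv c) ` S \<longleftrightarrow> \<phi> c w \<in> S" if "w \<in> topspace X" "S \<subseteq> topspace X" for w S
    proof
      assume "w \<in> \<phi> (inv c) ` S"
      then obtain u where "u \<in> S" "w = \<phi> (inv c) u" by blast
      then show "\<phi> c w \<in> S" using c that(2) by (simp add: subset_iff)
    next
      assume "\<phi> c w \<in> S"
      then have "\<phi> (inv c) (\<phi> c w) \<in> \<phi> (inv c) ` S" by (rule imageI)
      then show "w \<in> \<phi> (inv c) ` S" using c that(1) by simp
    qed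
    have NX: "?N1 \<subseteq> topspace X" using c sub by (auto simp: subset_iff)
    have "\<not> limit_set H X \<phi> \<subseteq> ?N2"
    proof (rule ping_pong_escapes[OF H k(1), where ?N1.0 = ?N1 and z = "\<phi> (inv c) z"])
      show "openin X ?N1" "openin X ?N2" using act_image_open c N(1,2) by simp_all
      show "?N1 \<inter> ?N2 = {}"
      proof (rule equals0I)
        fix w assume w: "w \<in> ?N1 \<inter> ?N2"
        then have "w \<in> topspace X" using NX by blast
        then have "\<phi> c w \<in> Nv \<inter> Np" using w mem_iff sub by simp
        then show False using disj(1) by simp
      qed
      show "\<phi> (inv c) z \<in> topspace X" using c z(1) by simp
      then show "\<phi> (inv c) z \<notin> ?N1" "\<phi> (inv c) z \<notin> ?N2"
        using mem_iff sub disj(2,3) c z(1) by simp_all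
      show "\<phi> k ` (topspace X - ?N1) \<subseteq> ?N2"
      proof (rule image_subsetI)
        fix w assume w: "w \<in> topspace X - ?N1"
        then have wX: "w \<in> topspace X" and "w \<notin> ?N1" by simp_all
        then have "\<phi> c w \<in> topspace X - Nv" using mem_iff[OF wX sub(1)] act_in[OF c wX] by simp
        then have "\<phi> (c \<otimes> k \<otimes> inv c) (\<phi> c w) \<in> Np" by (rule subsetD[OF k(2) imageI])
        then have "\<phi> c (\<phi> k w) \<in> Np" using c kG w by (simp add: act_mult)
        then show "\<phi> k w \<in> ?N2" using mem_iff sub kG w by simp
      qed
    qed
    moreover have "s \<in> ?N2" using s_in mem_iff sX sub by simp
    ultimately show False using lim by simp
  qed
  then show False using Db by simp
qed

text \<open>The heart of the proof. The elements \<open>inv s\<close> send \<open>a\<close> into \<open>E\<close>; corrected by elements of \<open>H\<close>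
they become the \<open>g s\<close> below, which in addition send the point \<open>v\<close> into \<open>K\<close>. The collapse of
these elements has repeller \<open>v\<close>, because the images of \<open>a\<close> and \<open>v\<close> have no common limit. That
leaves \<open>V\<close> no room to avoid the translates of a limit set with two points, and if there is only one
limit point, then it is conical.\<close>

lemma no_deep_orbit_points:
  assumes H: "subgroup H G" and S: "S \<subseteq> carrier G" "infinite S"
    and cosets: "\<And>s t. s \<in> S \<Longrightarrow> t \<in> S \<Longrightarrow> s \<noteq> t \<Longrightarrow> s <# H \<noteq> t <# H"
    and T: "T = limit_set (carrier G) X \<phi>"
    and V: "openin (subtopology X T) V" "v \<in> V" "V \<inter> (\<Union>s\<in>S. \<phi> s ` limit_set H X \<phi>) = {}"
    and E: "closedin X E" "\<And>h x. h \<in> H \<Longrightarrow> x \<in> E \<Longrightarrow> \<phi> h x \<in> E" "E \<inter> T \<subseteq> limit_set H X \<phi>"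
    and K: "closedin X K" "K \<inter> limit_set H X \<phi> = {}" "T - limit_set H X \<phi> \<subseteq> (\<Union>h\<in>H. \<phi> h ` K)"
    and a: "a \<in> topspace X" "a \<notin> T" "\<And>s. s \<in> S \<Longrightarrow> \<phi> (inv s) a \<in> E"
  shows False
proof -
  interpret H: subgroup H G by (rule H)
  have HG: "h \<in> carrier G" if "h \<in> H" for h using that H.subset by blast
  have SG: "s \<in> carrier G" if "s \<in> S" for s using that S(1) by blast
  have Gsub: "subgroup (carrier G) G" by (rule subgroup_self)
  obtain V' where V': "openin X V'" "V = V' \<inter> T"
    using V(1) unfolding openin_subtopology by (elim exE conjE)
  have vT: "v \<in> T" "v \<in> V'" using V(2) V'(2) by auto
  have vX: "v \<in> topspace X" using vT(1) T limit_set_subset by blast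
  have \<Lambda>X: "limit_set H X \<phi> \<subseteq> topspace X" by (rule limit_set_subset)
  have "\<exists>h\<in>H. \<exists>k\<in>K. \<phi> (inv s) v = \<phi> h k" if s: "s \<in> S" for s
  proof -
    have "\<phi> (inv s) v \<in> T"
      unfolding T by (rule limit_set_invariant[OF Gsub]) (use SG[OF s] vT(1) T in simp_all)
    moreover have "\<phi> (inv s) v \<notin> limit_set H X \<phi>"
    proof
      assume "\<phi> (inv s) v \<in> limit_set H X \<phi>"
      then have "\<phi> s (\<phi> (inv s) v) \<in> \<phi> s ` limit_set H X \<phi>" by (rule imageI)
      then have "v \<in> (\<Union>s\<in>S. \<phi> s ` limit_set H X \<phi>)" using s SG[OF s] vX by auto
      then show False using V(2,3) by blast
    qed
    ultimately have "\<phi> (inv s) v \<in> (\<Union>h\<in>H. \<phi> h ` K)" using K(3) by blast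
    then show ?thesis by blast
  qed
  then obtain \<eta> where \<eta>: "\<And>s. s \<in> S \<Longrightarrow> \<eta> s \<in> H" "\<And>s. s \<in> S \<Longrightarrow> \<exists>k\<in>K. \<phi> (inv s) v = \<phi> (\<eta> s) k"
    by metis
  define g where "g s = inv (\<eta> s) \<otimes> inv s" for s
  have g: "g s \<in> carrier G" "inv (g s) = s \<otimes> \<eta> s" if "s \<in> S" for s
    using \<eta>(1)[OF that] HG SG[OF that] unfolding g_def by (simp_all add: inv_mult_group)
  have gv: "\<phi> (g s) v \<in> K" if s: "s \<in> S" for s
  proof -
    obtain k where k: "k \<in> K" "\<phi> (inv s) v = \<phi> (\<eta> s) k" using \<eta>(2)[OF s] by blast
    have "k \<in> topspace X" using k(1) closedin_subset[OF K(1)] by blast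
    then show ?thesis
      using k HG[OF \<eta>(1)[OF s]] SG[OF s] vX unfolding g_def by (simp add: act_mult)
  qed
  have ga: "\<phi> (g s) a \<in> E" if s: "s \<in> S" for s
    using E(2)[of "inv (\<eta> s)" "\<phi> (inv s) a"] a(3)[OF s] \<eta>(1)[OF s] HG SG[OF s] a(1)
    unfolding g_def by (simp add: act_mult)
  \<comment> \<open>The correction by \<open>\<eta> s\<close> stays within the coset \<open>s <# H\<close>.\<close>
  have g_inj: "s = t" if st: "s \<in> S" "t \<in> S" "g s = g t" for s t
  proof (rule ccontr)
    assume "s \<noteq> t"
    have coset: "u <# H = (u \<otimes> \<eta> u) <# H" if "u \<in> S" for u
    proof (rule l_repr_independence[OF _ SG[OF that] H])
      show "u \<otimes> \<eta> u \<in> u <# H" unfolding l_coset_def using \<eta>(1)[OF that] by blast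
    qed
    have "s \<otimes> \<eta> s = t \<otimes> \<eta> t" using g(2)[OF st(1)] g(2)[OF st(2)] st(3) by simp
    then have "s <# H = t <# H" using coset[OF st(1)] coset[OF st(2)] by simp
    then show False using cosets[OF st(1,2) \<open>s \<noteq> t\<close>] by simp
  qed
  obtain F where F: "ultrafilter F" "\<forall>\<^sub>F s in F. s \<in> S" "\<forall>B. finite B \<longrightarrow> (\<forall>\<^sub>F s in F. s \<notin> B)"
    by (rule ultra_on_infinite_set[OF S(2)])
  have Fb: "F \<noteq> bot" using F(1) unfolding ultrafilter_def by simp
  have gG: "\<forall>\<^sub>F s in F. g s \<in> carrier G" using F(2) by eventually_elim (rule g(1))
  have g_nc: "\<forall>\<^sub>F s in F. g s \<noteq> c" for c
  proof -
    have "finite {s \<in> S. g s = c}"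
      by (rule finite_if_all_equal) (simp add: g_inj)
    from F(3)[rule_format, OF this] F(2) show ?thesis by eventually_elim simp
  qed
  obtain r s where col: "collapses F g r s" by (rule ultra_collapses[OF F(1) gG g_nc])
  have inv_nc: "\<forall>\<^sub>F i in F. inv (g i) \<noteq> c" for c
    using g_nc[of "inv c"] gG by eventually_elim auto
  have colinv: "collapses F (\<lambda>i. inv (g i)) s r" by (rule collapses_inverse[OF col gG])
  have invG: "\<forall>\<^sub>F i in F. inv (g i) \<in> carrier G" using gG by eventually_elim simp
  have sT: "s \<in> T" unfolding T by (rule attractor_in_limit_set[OF Gsub col Fb gG g_nc])
  have rT: "r \<in> T" unfolding T by (rule attractor_in_limit_set[OF Gsub colinv Fb invG inv_nc])
  have "limitin X (\<lambda>i. \<phi> (g i) a) s F"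
    by (rule collapses_pointwise[OF col]) (use a rT in auto)
  then have "s \<in> E"
    by (rule limitin_closed_mem[OF _ Fb E(1)]) (use F(2) in eventually_elim, rule ga)
  then have s\<Lambda>: "s \<in> limit_set H X \<phi>" using sT E(3) by blast
  have "r = v"
  proof (rule ccontr)
    assume "r \<noteq> v"
    have "limitin X (\<lambda>i. \<phi> (g i) v) s F"
      by (rule collapses_pointwise[OF col]) (use vX \<open>r \<noteq> v\<close> in auto)
    then have "s \<in> K"
      by (rule limitin_closed_mem[OF _ Fb K(1)]) (use F(2) in eventually_elim, rule gv)
    then show False using s\<Lambda> K(2) by blast
  qed
  have avoid: "\<forall>\<^sub>F i in F. \<phi> (inv (g i)) t \<in> T - V" if t: "t \<in> limit_set H X \<phi>" for t
    using F(2)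
  proof eventually_elim
    case (elim i)
    have tX: "t \<in> topspace X" using t \<Lambda>X by blast
    have "\<phi> (\<eta> i) t \<in> limit_set H X \<phi>" by (rule limit_set_invariant[OF H \<eta>(1)[OF elim] t])
    moreover have eq: "\<phi> (inv (g i)) t = \<phi> i (\<phi> (\<eta> i) t)"
      using g(2)[OF elim] SG[OF elim] HG[OF \<eta>(1)[OF elim]] tX by (simp add: act_mult)
    ultimately have "\<phi> (inv (g i)) t \<in> (\<Union>s\<in>S. \<phi> s ` limit_set H X \<phi>)" using elim by auto
    then have "\<phi> (inv (g i)) t \<notin> V" using V(3) by blast
    moreover have "\<phi> (inv (g i)) t \<in> T"
      unfolding T
    proof (rule limit_set_invariant[OF Gsub])
      show "inv (g i) \<in> carrier G" using g(1)[OF elim] by simp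
      show "t \<in> limit_set (carrier G) X \<phi>" using limit_set_mono[OF H.subset] t by blast
    qed
    ultimately show ?case by simp
  qed
  \<comment> \<open>A second limit point would be pulled to \<open>v\<close>, hence into \<open>V\<close>.\<close>
  have "t = s" if t: "t \<in> limit_set H X \<phi>" for t
  proof (rule ccontr)
    assume "t \<noteq> s"
    have "limitin X (\<lambda>i. \<phi> (inv (g i)) t) r F"
      by (rule collapses_pointwise[OF colinv]) (use t \<Lambda>X \<open>t \<noteq> s\<close> in auto)
    then have "\<forall>\<^sub>F i in F. \<phi> (inv (g i)) t \<in> V'"
      using limitinD V'(1) vT(2) \<open>r = v\<close> by metis
    with avoid[OF t] have "\<forall>\<^sub>F i in F. False" by eventually_elim (simp add: V'(2))
    then show False using Fb by simp
  qed
  then have lim: "limit_set H X \<phi> = {s}" using s\<Lambda> by blast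
  have ev: "\<forall>\<^sub>F i in F. \<phi> (inv (g i)) s \<in> topspace X - V'"
    using avoid[OF s\<Lambda>]
  proof eventually_elim
    case (elim i)
    then show ?case using limit_set_subset[of "carrier G"] unfolding V'(2) T by blast
  qed
  have ev': "\<forall>\<^sub>F i in F. \<phi> (inv (g i)) s \<in> topspace X" using ev by eventually_elim simp
  obtain p where p: "limitin X (\<lambda>i. \<phi> (inv (g i)) s) p F"
    by (rule ultra_limit_exists[OF compact_space_X F(1) ev'])
  have "p \<in> topspace X - V'"
    by (rule limitin_closed_mem[OF p Fb closedin_diff[OF closedin_topspace V'(1)] ev])
  then have "p \<noteq> r" using vT(2) \<open>r = v\<close> by auto
  then show False by (rule unique_limit_point_not_conical[OF H lim F(1) invG colinv p])
qed

section \<open>Cocompactness off the limit set\<close>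

text \<open>If there were no finite \<open>D\<close>, the elements sending \<open>a\<close> into \<open>E\<close> would fill infinitely many right
cosets of \<open>H\<close>. The inverses of representatives then lie in distinct left cosets, as required by
dynamical boundedness.\<close>

lemma finitely_many_orbit_representatives:
  assumes H: "subgroup H G" and bounded: "dynamically_bounded G X \<phi> H"
    and T: "T = limit_set (carrier G) X \<phi>"
    and E: "closedin X E" "\<And>h x. h \<in> H \<Longrightarrow> x \<in> E \<Longrightarrow> \<phi> h x \<in> E" "E \<inter> T \<subseteq> limit_set H X \<phi>"
    and K: "closedin X K" "K \<inter> limit_set H X \<phi> = {}" "T - limit_set H X \<phi> \<subseteq> (\<Union>h\<in>H. \<phi> h ` K)"
    and a: "a \<in> topspace X" "a \<notin> T"
  obtains D where "finite D" "D \<subseteq> E \<inter> orbit G \<phi> a" "E \<inter> orbit G \<phi> a \<subseteq> (\<Union>h\<in>H. \<phi> h ` D)"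
proof -
  interpret H: subgroup H G by (rule H)
  have HG: "h \<in> carrier G" if "h \<in> H" for h using that H.subset by blast
  define B where "B = {g \<in> carrier G. \<phi> g a \<in> E}"
  define \<rho> where "\<rho> c = (SOME g. g \<in> B \<and> H #> g = c)" for c
  define R where "R = \<rho> ` ((\<lambda>g. H #> g) ` B)"
  have \<rho>: "\<rho> (H #> g) \<in> B" "H #> \<rho> (H #> g) = H #> g" if "g \<in> B" for g
    using someI[of "\<lambda>g'. g' \<in> B \<and> H #> g' = H #> g" g] that unfolding \<rho>_def by simp_all
  have R_elim: "\<exists>b\<in>B. g = \<rho> (H #> b)" if "g \<in> R" for g
    using that unfolding R_def by (elim imageE) blast
  have RB: "R \<subseteq> B"
  proof
    fix g assume "g \<in> R"
    then obtain b where "b \<in> B" "g = \<rho> (H #> b)" using R_elim by metis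
    then show "g \<in> B" using \<rho>(1) by simp
  qed
  have R_rep: "\<rho> (H #> g) = g" if gR: "g \<in> R" for g
  proof -
    obtain b where b: "b \<in> B" "g = \<rho> (H #> b)" using R_elim[OF gR] by metis
    show ?thesis unfolding b(2) \<rho>(2)[OF b(1)] by (rule refl)
  qed
  have R_inj: "g = g'" if "g \<in> R" "g' \<in> R" "H #> g = H #> g'" for g g'
    using R_rep[OF that(1)] unfolding that(3) R_rep[OF that(2)] by (rule sym)
  show thesis
  proof (cases "finite R")
    case True
    let ?D = "(\<lambda>g. \<phi> g a) ` R"
    have "?D \<subseteq> E \<inter> orbit G \<phi> a" using RB unfolding B_def orbit_def by auto
    moreover have "E \<inter> orbit G \<phi> a \<subseteq> (\<Union>h\<in>H. \<phi> h ` ?D)"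
    proof
      fix x assume "x \<in> E \<inter> orbit G \<phi> a"
      then obtain g where g: "g \<in> carrier G" "x = \<phi> g a" "x \<in> E" unfolding orbit_def by blast
      then have gB: "g \<in> B" unfolding B_def by simp
      define g' where "g' = \<rho> (H #> g)"
      have g': "g' \<in> R" "g' \<in> carrier G" "H #> g' = H #> g"
        using \<rho>[OF gB] imageI[OF imageI[OF gB]] unfolding R_def g'_def B_def by simp_all
      have "g \<in> H #> g'" using rcos_self[OF g(1) H] g'(3) by simp
      then obtain h where h: "h \<in> H" "g = h \<otimes> g'" unfolding r_coset_def by blast
      then have "x = \<phi> h (\<phi> g' a)" using g(2) HG g'(2) a(1) by (simp add: act_mult)
      then show "x \<in> (\<Union>h\<in>H. \<phi> h ` ?D)" using h(1) g'(1) by blast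
    qed
    ultimately show thesis using that[of ?D] True by simp
  next
    case False
    let ?S = "(\<lambda>g. inv g) ` R"
    have RG: "g \<in> carrier G" if "g \<in> R" for g using subsetD[OF RB that] unfolding B_def by simp
    have SG: "?S \<subseteq> carrier G" by (rule image_subsetI) (simp add: RG)
    have "inj_on (\<lambda>g. inv g) R"
      by (rule inj_on_inverseI[where g = "\<lambda>g. inv g"]) (simp add: RG)
    then have infS: "infinite ?S" using False by (simp add: finite_image_iff)
    have cosets: "s <# H \<noteq> t <# H" if st: "s \<in> ?S" "t \<in> ?S" "s \<noteq> t" for s t
    proof
      assume eq: "s <# H = t <# H"
      obtain g where s: "s = inv g" "g \<in> R" using st(1) by (rule imageE)
      obtain g' where t: "t = inv g'" "g' \<in> R" using st(2) by (rule imageE)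
      have "s \<in> s <# H"
        using H.one_closed subsetD[OF SG st(1)] unfolding l_coset_def by (auto intro!: bexI[of _ \<one>])
      then have "s \<in> t <# H" by (simp only: eq)
      then obtain h where h: "h \<in> H" "inv g = inv g' \<otimes> h"
        unfolding s(1) t(1) l_coset_def by (elim UN_E singletonE) (rule that)
      have G: "g \<in> carrier G" "g' \<in> carrier G" "h \<in> carrier G" using RG[OF s(2)] RG[OF t(2)] HG[OF h(1)] .
      have "g = inv (inv g)" using G by simp
      also have "\<dots> = inv h \<otimes> g'" unfolding h(2) using G by (simp add: inv_mult_group)
      finally have "g \<in> H #> g'" unfolding r_coset_def using h(1) by blast
      then have "H #> g' = H #> g" by (rule repr_independence[OF _ G(2) H])
      then show False using R_inj[OF t(2) s(2)] s(1) t(1) st(3) by simp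
    qed
    have "\<exists>S0. S0 \<subseteq> ?S \<and> infinite S0 \<and>
        subtopology X T interior_of (T - (\<Union>s\<in>S0. \<phi> s ` limit_set H X \<phi>)) \<noteq> {}"
      using bounded SG infS cosets unfolding dynamically_bounded_def Let_def T[symmetric] by simp
    then obtain S0 where S0: "S0 \<subseteq> ?S" "infinite S0"
      "subtopology X T interior_of (T - (\<Union>s\<in>S0. \<phi> s ` limit_set H X \<phi>)) \<noteq> {}"
      by (elim exE conjE)
    define V where "V = subtopology X T interior_of (T - (\<Union>s\<in>S0. \<phi> s ` limit_set H X \<phi>))"
    have V: "openin (subtopology X T) V" "V \<inter> (\<Union>s\<in>S0. \<phi> s ` limit_set H X \<phi>) = {}"
      using interior_of_subset[of "subtopology X T"] unfolding V_def by auto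
    obtain v where v: "v \<in> V" using S0(3) unfolding V_def by blast
    have False
    proof (rule no_deep_orbit_points[OF H _ S0(2) _ T V(1) v V(2) E K a])
      show "S0 \<subseteq> carrier G" using S0(1) SG by (rule subset_trans)
      show "s <# H \<noteq> t <# H" if "s \<in> S0" "t \<in> S0" "s \<noteq> t" for s t
        using cosets[OF subsetD[OF S0(1) that(1)] subsetD[OF S0(1) that(2)] that(3)] .
      show "\<phi> (inv s) a \<in> E" if sS0: "s \<in> S0" for s
      proof -
        obtain g where "s = inv g" "g \<in> R" using subsetD[OF S0(1) sS0] by (rule imageE)
        then show ?thesis using subsetD[OF RB, of g] unfolding B_def by simp
      qed
    qed
    then show thesis ..
  qed
qed

theorem cocompact_on_complement_of_limit_set:
  assumes H: "subgroup H G" and bounded: "dynamically_bounded G X \<phi> H"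
    and T: "T = limit_set (carrier G) X \<phi>" and A: "topspace X = T \<union> A" "T \<inter> A = {}"
    and fin: "finite (orbits G A \<phi>)"
    and coc: "acts_cocompactly H (subtopology X (T - limit_set H X \<phi>)) \<phi>"
  shows "acts_cocompactly H (subtopology X (topspace X - limit_set H X \<phi>)) \<phi>"
proof -
  interpret H: subgroup H G by (rule H)
  have HG: "h \<in> carrier G" if "h \<in> H" for h using that H.subset by blast
  define \<Lambda> where "\<Lambda> = limit_set H X \<phi>"
  have \<Lambda>X: "\<Lambda> \<subseteq> topspace X" unfolding \<Lambda>_def by (rule limit_set_subset)
  have \<Lambda>T: "\<Lambda> \<subseteq> T" unfolding \<Lambda>_def T by (rule limit_set_mono[OF H.subset])
  have \<Lambda>_inv: "\<phi> h x \<in> \<Lambda> \<longleftrightarrow> x \<in> \<Lambda>" if h: "h \<in> H" and x: "x \<in> topspace X" for h x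
  proof
    assume "\<phi> h x \<in> \<Lambda>"
    then have "\<phi> (inv h) (\<phi> h x) \<in> \<Lambda>"
      unfolding \<Lambda>_def using limit_set_invariant[OF H, of "inv h"] h by simp
    then show "x \<in> \<Lambda>" using HG[OF h] x by simp
  next
    assume "x \<in> \<Lambda>"
    then show "\<phi> h x \<in> \<Lambda>" unfolding \<Lambda>_def by (rule limit_set_invariant[OF H h])
  qed
  obtain K where K: "compactin (subtopology X (T - \<Lambda>)) K"
      "(\<Union>h\<in>H. \<phi> h ` K) = topspace (subtopology X (T - \<Lambda>))"
    using coc unfolding acts_cocompactly_def \<Lambda>_def by blast
  have KX: "compactin X K" and K\<Lambda>: "K \<subseteq> T - \<Lambda>" using K(1) unfolding compactin_subtopology by simp_all
  have K_closed: "closedin X K" by (rule compactin_imp_closedin[OF Hausdorff_space_X KX])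
  have K_cover: "T - \<Lambda> \<subseteq> (\<Union>h\<in>H. \<phi> h ` K)" unfolding K(2) using A(1) by auto
  have "normal_space X"
    by (rule compact_Hausdorff_or_regular_imp_normal_space) simp_all
  moreover have "closedin X \<Lambda>" unfolding \<Lambda>_def by (rule closedin_limit_set)
  moreover have "disjnt K \<Lambda>" using K\<Lambda> unfolding disjnt_def by blast
  ultimately obtain U V where UV: "openin X U" "openin X V" "K \<subseteq> U" "\<Lambda> \<subseteq> V" "disjnt U V"
    using K_closed unfolding normal_space_def by metis
  define C where "C = topspace X - V"
  have U: "openin X U" "K \<subseteq> U" "closedin X C" "U \<subseteq> C" "C \<inter> \<Lambda> = {}"
    using UV openin_subset[OF UV(1)] unfolding C_def disjnt_def
    by (simp_all add: closedin_diff) blast+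
  define E where "E = topspace X - (\<Union>h\<in>H. \<phi> h ` U)"
  have E_closed: "closedin X E"
    unfolding E_def
  proof (intro closedin_diff closedin_topspace openin_Union)
    fix W assume "W \<in> (\<lambda>h. \<phi> h ` U) ` H"
    then show "openin X W" using act_image_open HG U(1) by auto
  qed
  have E_inv: "\<phi> h x \<in> E" if h: "h \<in> H" and x: "x \<in> E" for h x
  proof -
    have xX: "x \<in> topspace X" using x unfolding E_def by simp
    have "\<phi> h x \<notin> \<phi> k ` U" if k: "k \<in> H" for k
    proof
      assume "\<phi> h x \<in> \<phi> k ` U"
      then obtain u where u: "u \<in> U" "\<phi> h x = \<phi> k u" by blast
      have uX: "u \<in> topspace X" using u(1) openin_subset[OF U(1)] by blast
      have "x = \<phi> (inv h) (\<phi> h x)" using HG[OF h] xX by simp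
      also have "\<dots> = \<phi> (inv h \<otimes> k) u" unfolding u(2) using HG h k uX by (simp add: act_mult)
      finally have "x \<in> \<phi> (inv h \<otimes> k) ` U" using u(1) by (rule image_eqI)
      moreover have "inv h \<otimes> k \<in> H" using h k by simp
      ultimately show False using x unfolding E_def by blast
    qed
    then show ?thesis using HG[OF h] xX unfolding E_def by simp
  qed
  have E_T: "E \<inter> T \<subseteq> \<Lambda>"
  proof
    fix x assume x: "x \<in> E \<inter> T"
    show "x \<in> \<Lambda>"
    proof (rule ccontr)
      assume "x \<notin> \<Lambda>"
      then have "x \<in> (\<Union>h\<in>H. \<phi> h ` K)" using x K_cover by blast
      then have "x \<in> (\<Union>h\<in>H. \<phi> h ` U)" using U(2) by blast
      then show False using x unfolding E_def by simp
    qed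
  qed
  have "\<exists>D. finite D \<and> D \<subseteq> E \<inter> orbit G \<phi> a \<and> E \<inter> orbit G \<phi> a \<subseteq> (\<Union>h\<in>H. \<phi> h ` D)" if "a \<in> A" for a
  proof -
    have a: "a \<in> topspace X" "a \<notin> T" using that A by blast+
    have K': "K \<inter> limit_set H X \<phi> = {}" using K\<Lambda> unfolding \<Lambda>_def by blast
    show ?thesis
      using finitely_many_orbit_representatives[OF H bounded T E_closed E_inv E_T[unfolded \<Lambda>_def]
          K_closed K' K_cover[unfolded \<Lambda>_def] a]
      by metis
  qed
  then obtain D where D: "\<And>a. a \<in> A \<Longrightarrow> finite (D a)"
    "\<And>a. a \<in> A \<Longrightarrow> D a \<subseteq> E \<inter> orbit G \<phi> a"
    "\<And>a. a \<in> A \<Longrightarrow> E \<inter> orbit G \<phi> a \<subseteq> (\<Union>h\<in>H. \<phi> h ` D a)" by metis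
  have "orbits G A \<phi> = orbit G \<phi> ` A" unfolding orbits_def by blast
  then obtain A0 where A0: "A0 \<subseteq> A" "finite A0" "orbit G \<phi> ` A0 = orbit G \<phi> ` A"
    using fin finite_subset_image[of "orbit G \<phi> ` A" "orbit G \<phi>" A] by auto
  \<comment> \<open>Removing \<open>\<Lambda>\<close> loses nothing: by invariance, points outside \<open>\<Lambda>\<close> have their representatives outside \<open>\<Lambda>\<close>.\<close>
  define D0 where "D0 = (\<Union>a\<in>A0. D a) - \<Lambda>"
  have D0_fin: "finite D0" unfolding D0_def using A0(1,2) D(1) by auto
  have D0_X: "D0 \<subseteq> topspace X" unfolding D0_def using A0(1) D(2) E_def by blast
  have CX: "C \<subseteq> topspace X" by (rule closedin_subset[OF U(3)])
  let ?Y = "subtopology X (topspace X - \<Lambda>)"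
  have "compactin ?Y (C \<union> D0)"
    unfolding compactin_subtopology
  proof
    show "compactin X (C \<union> D0)"
      by (intro compactin_Un closedin_compact_space finite_imp_compactin) (use U(3) D0_fin D0_X in simp_all)
    show "C \<union> D0 \<subseteq> topspace X - \<Lambda>" using CX D0_X U(5) unfolding D0_def by blast
  qed
  moreover have "(\<Union>h\<in>H. \<phi> h ` (C \<union> D0)) = topspace ?Y"
  proof
    show "(\<Union>h\<in>H. \<phi> h ` (C \<union> D0)) \<subseteq> topspace ?Y"
    proof (intro UN_least image_subsetI)
      fix h x assume h: "h \<in> H" and x: "x \<in> C \<union> D0"
      then have "x \<in> topspace X" "x \<notin> \<Lambda>" using CX D0_X U(5) unfolding D0_def by blast+
      then show "\<phi> h x \<in> topspace ?Y" using \<Lambda>_inv[OF h] HG[OF h] by simp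
    qed
    show "topspace ?Y \<subseteq> (\<Union>h\<in>H. \<phi> h ` (C \<union> D0))"
    proof
      fix x assume "x \<in> topspace ?Y"
      then have x: "x \<in> topspace X" "x \<notin> \<Lambda>" by simp_all
      show "x \<in> (\<Union>h\<in>H. \<phi> h ` (C \<union> D0))"
      proof (cases "x \<in> E")
        case False
        then have "x \<in> (\<Union>h\<in>H. \<phi> h ` U)" using x(1) unfolding E_def by simp
        then show ?thesis using U(4) by blast
      next
        case True
        then have "x \<in> A" using x(2) E_T A(1) x(1) by blast
        then obtain a where a: "a \<in> A0" "orbit G \<phi> a = orbit G \<phi> x"
          using A0(3) by (metis imageE imageI)
        have "x \<in> E \<inter> orbit G \<phi> a" using True a(2) action.orbit_refl[OF x(1)] by simp
        then obtain h d where h: "h \<in> H" "d \<in> D a" "x = \<phi> h d" using D(3)[of a] a(1) A0(1) by blast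
        have "d \<in> topspace X" using D(2)[of a] a(1) A0(1) h(2) unfolding E_def by blast
        then have "d \<notin> \<Lambda>" using \<Lambda>_inv[OF h(1)] x(2) h(3) by simp
        then have "d \<in> C \<union> D0" using h(2) a(1) unfolding D0_def by blast
        then show ?thesis using h(1,3) by blast
      qed
    qed
  qed
  ultimately show ?thesis unfolding acts_cocompactly_def \<Lambda>_def by blast
qed

end

theorem proposition9p1p3:
  fixes G :: "('g, 'm) monoid_scheme" and X :: "'b topology"
    and \<phi> :: "'g \<Rightarrow> 'b \<Rightarrow> 'b" and T A :: "'b set" and H :: "'g set"
  assumes "group G"
    and "compactum X"
    and "three_discontinuous G X \<phi>"
    and "topspace X = T \<union> A" and "T \<inter> A = {}"
    and "T = limit_set (carrier G) X \<phi>"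
    and "A \<noteq> {}"
    and "subtopology X A = discrete_topology A"
    and "finite (orbits G A \<phi>)"
    and "subgroup H G"
    and "dynamically_bounded G X \<phi> H"
    and "acts_cocompactly H (subtopology X (T - limit_set H X \<phi>)) \<phi>"
  shows "acts_cocompactly H (subtopology X (topspace X - limit_set H X \<phi>)) \<phi>"
proof -
  interpret three_discontinuous_group G X \<phi>
    using assms(1-3) by (simp add: three_discontinuous_group_def three_discontinuous_group_axioms_def)
  show ?thesis
    by (rule cocompact_on_complement_of_limit_set[OF assms(10,11,6,4,5,9,12)])
qed

end
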